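(* Let $t\ge 4$ and $m$ be integers with $1\le m<t-1$. Suppose $d_{\mathrm{plan}}$ is a uniform balanced repeated measurements design (UBRMD) with $t$ treatments, $t$ time periods and $s=gt$ subjects, and let $d_{\min}$ be the design consisting of the first $t-m$ periods of $d_{\mathrm{plan}}$. Then an upper bound to the maximum loss of precision due to subject dropout, $$ML_{d_{\mathrm{plan}}}=\frac{H_{d_{\mathrm{plan}}}-H_{d_{\min}}}{H_{d_{\mathrm{plan}}}}=1-\frac{\operatorname{trace}\big(C_D^{d_{\mathrm{plan}}}\big)^{+}}{\operatorname{trace}\big(C_D^{d_{\min}}\big)^{+}},$$ is given by $ML_{d_{\mathrm{plan}}}\le UML(t,m)$, where $$UML(t,m)=1-\frac{(t^2-t-1)\,\theta_L(t,m)}{t(t-2)(t+1)},\qquad \theta_L(t,m)=\frac{t}{t-m}\left[(t-2m)-\frac{t(m+1)^2}{(t-m)^2-(t+1)-m(m+1)}\right].$$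
   Context: A (crossover) design with $p$ periods, $s$ subjects and $t$ treatments labelled $0,\dots,t-1$ assigns a treatment $d(k,i)$ to each subject $i\in\{1,\dots,s\}$ in each period $k\in\{1,\dots,p\}$. It is uniform if each subject receives every treatment in the same number of periods and in each period every treatment is given to the same number of subjects. It is balanced if, in the order of application, each treatment is immediately preceded by every other treatment the same number of times and is never immediately preceded by itself. A UBRMD with $t$ treatments, $t$ periods and $s=gt$ subjects ($g$ a positive integer) is a uniform and balanced such design (so each subject receives each treatment exactly once, and each treatment appears $g$ times in each period). Subjects may drop out (without returning) only after the first $t-m$ periods; $d_{\min}$ is the worst case, in which all subjects drop out after period $t-m$. Model: $Y=X_S\beta+X_P\alpha+X_D\tau+X_C\rho+\epsilon$, with fixed subject, period, direct treatment and carry-over effects. With rows indexed by (subject $i$, period $k$): $X_S=I_s\otimes\mathbf 1_p$, $X_P=\mathbf 1_s\otimes I_p$; the row of $X_D$ for $(i,k)$ has a $1$ in the column of treatment $d(k,i)$ and $0$ elsewhere; the row of $X_C$ for $(i,k)$ has a $1$ in the column of treatment $d(k-1,i)$ and $0$ elsewhere if $k\ge2$, and is zero if $k=1$. Put $N_{ab}=X_a'X_b$ for $a,b\in\{S,P,D,C\}$, $r_D=N_{DS}\mathbf 1_s$, $r_C=N_{CS}\mathbf 1_s$, $r_D^\delta=\mathrm{diag}(r_D)$, $r_C^\delta=\mathrm{diag}(r_C)$, and $C_{11}=r_D^\delta+\frac1{ps}r_Dr_D'-\frac1pN_{DS}N_{SD}-\frac1sN_{DP}N_{PD}$, $C_{22}=r_C^\delta+\frac1{ps}r_Cr_C'-\frac1pN_{CS}N_{SC}-\frac1sN_{CP}N_{PC}$,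 $C_{12}=N_{DC}+\frac1{ps}r_Dr_C'-\frac1pN_{DS}N_{SC}-\frac1sN_{DP}N_{PC}$, $C_{21}=C_{12}'$. The direct-effects information matrix of the design $d$ is the $t\times t$ matrix $C_D^d=C_{11}-C_{12}C_{22}^{-}C_{21}$, where $M^-$ is any generalized inverse ($MM^-M=M$). These are computed with $s=gt$ and with $p=t$ for $d_{\mathrm{plan}}$, $p=t-m$ for $d_{\min}$. $M^+$ denotes the Moore–Penrose inverse. The precision of a connected design $d$ (one in which all elementary contrasts $\tau_i-\tau_j$ are estimable) is measured by $H_d=(t-1)/\operatorname{trace}(C_D^d)^+$, the harmonic mean of the nonzero eigenvalues of $C_D^d$. Here $'$ is transpose, $I_a$ is the $a\times a$ identity matrix and $\mathbf 1_a$ is the all-ones vector of length $a$.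
   Formalization: The bound is proved only when (t-m)^2-(t+1)-m(m+1)>0; when this is negative, UML(t,m)<0 while the loss is nonnegative for connected d_min, so the claim fails (e.g. t=4, m=2, all 24 permutations). *)

theory Defs
  imports Jordan_Normal_Form.Matrix Complex_Main
begin

definition ones :: "nat \<Rightarrow> real mat" where
  "ones n = mat n 1 (\<lambda>_. 1)"

definition kronecker :: "real mat \<Rightarrow> real mat \<Rightarrow> real mat" where
  "kronecker A B = mat (dim_row A * dim_row B) (dim_col A * dim_col B)
     (\<lambda>(i, j). A $$ (i div dim_row B, j div dim_col B) * B $$ (i mod dim_row B, j mod dim_col B))"

definition trace :: "real mat \<Rightarrow> real" where
  "trace A = (\<Sum>i<dim_row A. A $$ (i, i))"

definition generalized_inverse :: "real mat \<Rightarrow> real mat \<Rightarrow> bool" where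
  "generalized_inverse A G \<longleftrightarrow> G \<in> carrier_mat (dim_col A) (dim_row A) \<and> A * G * A = A"

definition is_moore_penrose :: "real mat \<Rightarrow> real mat \<Rightarrow> bool" where
  "is_moore_penrose A X \<longleftrightarrow> X \<in> carrier_mat (dim_col A) (dim_row A) \<and>
     A * X * A = A \<and> X * A * X = X \<and>
     transpose_mat (A * X) = A * X \<and> transpose_mat (X * A) = X * A"

definition moore_penrose :: "real mat \<Rightarrow> real mat" where
  "moore_penrose A = (THE X. is_moore_penrose A X)"

text \<open>
  A design is a function \<open>d\<close>, where \<open>d k i\<close> is the treatment given in period \<open>k\<close> to subject \<open>i\<close>.
  Periods, subjects and treatments are all numbered from 0, so \<open>k < p\<close>, \<open>i < s\<close> and \<open>d k i < t\<close>;
  values of \<open>d\<close> outside this range are irrelevant. The design consisting of the first \<open>q \<le> p\<close>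
  periods is the same function, used with \<open>q\<close> in place of \<open>p\<close>.
\<close>

type_synonym design = "nat \<Rightarrow> nat \<Rightarrow> nat"

definition is_design :: "nat \<Rightarrow> nat \<Rightarrow> nat \<Rightarrow> design \<Rightarrow> bool" where
  "is_design p s t d \<longleftrightarrow> (\<forall>k<p. \<forall>i<s. d k i < t)"

definition uniform :: "nat \<Rightarrow> nat \<Rightarrow> nat \<Rightarrow> design \<Rightarrow> bool" where
  "uniform p s t d \<longleftrightarrow>
     (\<forall>i<s. \<forall>a<t. \<forall>b<t. card {k. k < p \<and> d k i = a} = card {k. k < p \<and> d k i = b}) \<and>
     (\<forall>k<p. \<forall>a<t. \<forall>b<t. card {i. i < s \<and> d k i = a} = card {i. i < s \<and> d k i = b})"

definition precedence_count :: "nat \<Rightarrow> nat \<Rightarrow> design \<Rightarrow> nat \<Rightarrow> nat \<Rightarrow> nat" where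
  "precedence_count p s d a b =
     card {(k, i). Suc k < p \<and> i < s \<and> d k i = a \<and> d (Suc k) i = b}"

definition balanced :: "nat \<Rightarrow> nat \<Rightarrow> nat \<Rightarrow> design \<Rightarrow> bool" where
  "balanced p s t d \<longleftrightarrow>
     (\<exists>l. \<forall>a<t. \<forall>b<t. precedence_count p s d a b = (if a = b then 0 else l))"

definition UBRMD :: "nat \<Rightarrow> nat \<Rightarrow> design \<Rightarrow> bool" where
  "UBRMD t g d \<longleftrightarrow>
     g > 0 \<and> is_design t (g * t) t d \<and> uniform t (g * t) t d \<and> balanced t (g * t) t d"

text \<open>Row \<open>r\<close> of the model matrices belongs to subject \<open>r div p\<close> and period \<open>r mod p\<close>.\<close>

definition X_S :: "nat \<Rightarrow> nat \<Rightarrow> real mat" where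
  "X_S p s = kronecker (1\<^sub>m s) (ones p)"

definition X_P :: "nat \<Rightarrow> nat \<Rightarrow> real mat" where
  "X_P p s = kronecker (ones s) (1\<^sub>m p)"

definition X_D :: "nat \<Rightarrow> nat \<Rightarrow> nat \<Rightarrow> design \<Rightarrow> real mat" where
  "X_D p s t d = mat (s * p) t (\<lambda>(r, a). if d (r mod p) (r div p) = a then 1 else 0)"

definition X_C :: "nat \<Rightarrow> nat \<Rightarrow> nat \<Rightarrow> design \<Rightarrow> real mat" where
  "X_C p s t d = mat (s * p) t
     (\<lambda>(r, a). if r mod p \<noteq> 0 \<and> d (r mod p - 1) (r div p) = a then 1 else 0)"

text \<open>
  For effects with model matrices \<open>A\<close> and \<open>B\<close> and with \<open>r\<^sub>A = A' X_S 1\<close>, \<open>r\<^sub>B = B' X_S 1\<close>,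
  this is \<open>N + r\<^sub>A r\<^sub>B' / (p s) - (A' X_S) (X_S' B) / p - (A' X_P) (X_P' B) / s\<close>.
  It is used with \<open>N = A' B\<close>, which is written as the diagonal matrix of \<open>r\<^sub>A\<close> when \<open>A = B\<close>.
\<close>

definition adjusted :: "nat \<Rightarrow> nat \<Rightarrow> real mat \<Rightarrow> real mat \<Rightarrow> real mat \<Rightarrow> real mat" where
  "adjusted p s N A B =
     (let N_AS = transpose_mat A * X_S p s; N_SB = transpose_mat (X_S p s) * B;
          N_AP = transpose_mat A * X_P p s; N_PB = transpose_mat (X_P p s) * B;
          r_A = N_AS * ones s; r_B = transpose_mat B * X_S p s * ones s
      in N + (1 / (real p * real s)) \<cdot>\<^sub>m (r_A * transpose_mat r_B)
           - (1 / real p) \<cdot>\<^sub>m (N_AS * N_SB) - (1 / real s) \<cdot>\<^sub>m (N_AP * N_PB))"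

definition replication_diag :: "nat \<Rightarrow> nat \<Rightarrow> nat \<Rightarrow> real mat \<Rightarrow> real mat" where
  "replication_diag p s t A =
     (let r = transpose_mat A * X_S p s * ones s in mat_diag t (\<lambda>a. r $$ (a, 0)))"

definition C11 :: "nat \<Rightarrow> nat \<Rightarrow> nat \<Rightarrow> design \<Rightarrow> real mat" where
  "C11 p s t d =
     adjusted p s (replication_diag p s t (X_D p s t d)) (X_D p s t d) (X_D p s t d)"

definition C22 :: "nat \<Rightarrow> nat \<Rightarrow> nat \<Rightarrow> design \<Rightarrow> real mat" where
  "C22 p s t d =
     adjusted p s (replication_diag p s t (X_C p s t d)) (X_C p s t d) (X_C p s t d)"

definition C12 :: "nat \<Rightarrow> nat \<Rightarrow> nat \<Rightarrow> design \<Rightarrow> real mat" where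
  "C12 p s t d =
     adjusted p s (transpose_mat (X_D p s t d) * X_C p s t d) (X_D p s t d) (X_C p s t d)"

definition C21 :: "nat \<Rightarrow> nat \<Rightarrow> nat \<Rightarrow> design \<Rightarrow> real mat" where
  "C21 p s t d = transpose_mat (C12 p s t d)"

text \<open>The generalized inverse of \<open>C22\<close> is arbitrary, so this is a relation between \<open>d\<close> and \<open>C\<close>.\<close>

definition direct_information_matrix ::
    "nat \<Rightarrow> nat \<Rightarrow> nat \<Rightarrow> design \<Rightarrow> real mat \<Rightarrow> bool" where
  "direct_information_matrix p s t d C \<longleftrightarrow>
     (\<exists>G. generalized_inverse (C22 p s t d) G \<and>
          C = C11 p s t d - C12 p s t d * G * C21 p s t d)"

text \<open>
  For a connected design with information matrix \<open>C\<close>, \<open>precision t C\<close> is the harmonic mean of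
  the \<open>t - 1\<close> nonzero eigenvalues of \<open>C\<close>. The formula is used for every \<open>C\<close>.
\<close>

definition precision :: "nat \<Rightarrow> real mat \<Rightarrow> real" where
  "precision t C = (real t - 1) / trace (moore_penrose C)"

definition precision_loss :: "nat \<Rightarrow> real mat \<Rightarrow> real mat \<Rightarrow> real" where
  "precision_loss t C_plan C_min =
     (precision t C_plan - precision t C_min) / precision t C_plan"

text \<open>
  For \<open>d\<close> the first \<open>t - m\<close> periods of a UBRMD, \<open>g * theta_denom t m / (t - m)\<close> bounds the
  eigenvalues of \<open>C22\<close> on contrasts from below. When it is positive, \<open>g * theta_L t m\<close> bounds
  those of the direct-effects information matrix from below. When it is negative, \<open>UML t m < 0\<close>,
  which does not bound the loss for any connected \<open>d\<close>.
\<close>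

definition theta_denom :: "nat \<Rightarrow> nat \<Rightarrow> real" where
  "theta_denom t m = (real t - real m)\<^sup>2 - (real t + 1) - real m * (real m + 1)"

definition theta_L :: "nat \<Rightarrow> nat \<Rightarrow> real" where
  "theta_L t m = real t / (real t - real m) *
     ((real t - 2 * real m) - real t * (real m + 1)\<^sup>2 / theta_denom t m)"

definition UML :: "nat \<Rightarrow> nat \<Rightarrow> real" where
  "UML t m = 1 - ((real t)\<^sup>2 - real t - 1) * theta_L t m /
     (real t * (real t - 2) * (real t + 1))"

end

theory Submission
  imports Defs "HOL-Library.Function_Algebras"
begin

text \<open>
  The joint quadratic form \<open>Q(x, y) = x' C11 x + 2 x' C12 y + y' C22 y\<close> is the residual sum of
  squares of the response \<open>x(d(k, i)) + y(d(k - 1, i))\<close> after elimination of subject and period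
  effects, and the form of the information matrix at \<open>x\<close> is the minimum of \<open>Q(x, y)\<close> over \<open>y\<close>.
  For contrasts \<open>x\<close> and \<open>y\<close>, balance reduces every sum over the periods of a subject to a sum
  over the periods lost to dropout, which the weighted arithmetic-geometric mean inequality
  controls; this gives \<open>Q(x, y) \<ge> g \<theta>\<^sub>L(t, m) |x|\<^sup>2\<close>. Hence the trace of the Moore-Penrose inverse
  is at most \<open>(t - 1) / (g \<theta>\<^sub>L(t, m))\<close>. For the full design, \<open>m = 0\<close>, the bound is attained at
  every \<open>x\<close>, and \<open>UML(t, m) = 1 - \<theta>\<^sub>L(t, m) / \<theta>\<^sub>L(t, 0)\<close>. If \<open>\<theta>\<^sub>L(t, m) \<le> 0\<close> the claim only needs
  that the information matrix is positive semidefinite.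
\<close>

subsection \<open>The residual sum of squares of a truncated design\<close>

text \<open>For the truncated design, \<open>C12\<close> and \<open>C22\<close> depend on which
  treatments each subject loses, while uniformity and balance fix only counts over full periods and
  over all \<open>t - 1\<close> successions. Working with \<open>Q(x, y)\<close> avoids inverting
  \<open>C22\<close>: a lower bound needs only an estimate valid for all pairs of contrasts, and
  every trial \<open>y\<close> gives an upper bound for the information matrix. Spectral
  decompositions are avoided in the same spirit: a trace is a sum of quadratic forms at unit
  vectors, and bounds for a form on contrasts pass to the Moore-Penrose inverse by completing
  squares. The hypothesis \<open>theta_denom t m > 0\<close> acts in two places: it makes
  \<open>C22\<close> positive definite on contrasts, so that the minimum of \<open>Q\<close>
  describes the information matrix whichever generalized inverse is chosen, and it makes the weight
  in the arithmetic-geometric mean inequality positive.\<close>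

lemma two_mult_le:
  fixes u v c :: real
  assumes "c > 0"
  shows "2 * (u * v) \<le> u\<^sup>2 / c + c * v\<^sup>2"
proof -
  have "0 \<le> (u - c * v)\<^sup>2 / c" using assms by simp
  also have "\<dots> = u\<^sup>2 / c + c * v\<^sup>2 - 2 * (u * v)"
    using assms by (simp add: power2_eq_square field_simps)
  finally show ?thesis by simp
qed

text \<open>Every term of one sum is paired with every term of the other. Once the squares are
  summed over all subjects, X / c and c * Y then carry the same factor
  \<open>card A * card B\<close>, so the weight c can be shared with the estimates for single
  products.\<close>

lemma two_sum_mult_le:
  fixes f :: "'a \<Rightarrow> real" and h :: "'b \<Rightarrow> real"
  assumes "c > 0"
  shows "2 * ((\<Sum>a\<in>A. f a) * (\<Sum>b\<in>B. h b))
    \<le> real (card B) / c * (\<Sum>a\<in>A. (f a)\<^sup>2) + real (card A) * c * (\<Sum>b\<in>B. (h b)\<^sup>2)"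
proof -
  have "2 * ((\<Sum>a\<in>A. f a) * (\<Sum>b\<in>B. h b)) = (\<Sum>a\<in>A. \<Sum>b\<in>B. 2 * (f a * h b))"
    unfolding sum_product by (simp only: sum_distrib_left)
  also have "\<dots> \<le> (\<Sum>a\<in>A. \<Sum>b\<in>B. (f a)\<^sup>2 / c + c * (h b)\<^sup>2)"
    by (intro sum_mono two_mult_le assms)
  also have "\<dots> = real (card B) / c * (\<Sum>a\<in>A. (f a)\<^sup>2) + real (card A) * c * (\<Sum>b\<in>B. (h b)\<^sup>2)"
    by (simp add: sum.distrib sum_distrib_left sum_distrib_right mult_ac)
  finally show ?thesis .
qed

lemma sum_power2_le:
  fixes f :: "'a \<Rightarrow> real"
  shows "(\<Sum>a\<in>A. f a)\<^sup>2 \<le> real (card A) * (\<Sum>a\<in>A. (f a)\<^sup>2)"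
  using two_sum_mult_le[of 1 f A f A] by (simp add: power2_eq_square)

text \<open>The bilinear form of the projection onto the orthogonal complement of the subject and
  period effects. These two spaces meet in the constants, hence the grand mean is added back
  once.\<close>

definition residual_form ::
    "nat \<Rightarrow> nat \<Rightarrow> (nat \<Rightarrow> nat \<Rightarrow> real) \<Rightarrow> (nat \<Rightarrow> nat \<Rightarrow> real) \<Rightarrow> real" where
  "residual_form p s v w =
     (\<Sum>i<s. \<Sum>k<p. v k i * w k i)
     + (\<Sum>i<s. \<Sum>k<p. v k i) * (\<Sum>i<s. \<Sum>k<p. w k i) / (real p * real s)
     - (\<Sum>i<s. (\<Sum>k<p. v k i) * (\<Sum>k<p. w k i)) / real p
     - (\<Sum>k<p. (\<Sum>i<s. v k i) * (\<Sum>i<s. w k i)) / real s"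

definition direct_part :: "design \<Rightarrow> (nat \<Rightarrow> real) \<Rightarrow> nat \<Rightarrow> nat \<Rightarrow> real" where
  "direct_part d x k i = x (d k i)"

definition carry_part :: "design \<Rightarrow> (nat \<Rightarrow> real) \<Rightarrow> nat \<Rightarrow> nat \<Rightarrow> real" where
  "carry_part d y k i = (if k = 0 then 0 else y (d (k - 1) i))"

text \<open>Kept expanded, so that the three terms are the forms of \<open>C11\<close>,
  \<open>C12\<close> and \<open>C22\<close>; \<open>joint_form_square\<close> recombines them for
  contrasts.\<close>

definition joint_form ::
    "nat \<Rightarrow> nat \<Rightarrow> design \<Rightarrow> (nat \<Rightarrow> real) \<Rightarrow> (nat \<Rightarrow> real) \<Rightarrow> real" where
  "joint_form p s d x y =
     residual_form p s (direct_part d x) (direct_part d x)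
     + 2 * residual_form p s (direct_part d x) (carry_part d y)
     + residual_form p s (carry_part d y) (carry_part d y)"

lemma residual_form_commute: "residual_form p s v w = residual_form p s w v"
  by (simp add: residual_form_def mult.commute)

text \<open>Period effects lie in the space that is projected out. This is the source of the zero
  row sums of all information matrices, see \<open>residual_form_one_vec\<close>.\<close>

lemma residual_form_period_effect:
  assumes "p > 0" "s > 0"
  shows "residual_form p s v (\<lambda>k i. b k) = 0"
proof -
  have "(\<Sum>i<s. \<Sum>k<p. v k i * b k) = (\<Sum>k<p. (\<Sum>i<s. v k i) * (real s * b k)) / real s"
    using assms by (subst sum.swap) (simp add: sum_distrib_right sum_divide_distrib)
  moreover have "(\<Sum>i<s. \<Sum>k<p. v k i) * (\<Sum>i<s. \<Sum>k<p. b k) / (real p * real s)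
      = (\<Sum>i<s. (\<Sum>k<p. v k i) * (\<Sum>k<p. b k)) / real p"
    using assms by (simp flip: sum_distrib_right)
  ultimately show ?thesis by (simp add: residual_form_def)
qed

lemma joint_form_square:
  assumes "\<And>k. k < p \<Longrightarrow> (\<Sum>i<s. direct_part d x k i) = 0"
    and "\<And>k. k < p \<Longrightarrow> (\<Sum>i<s. carry_part d y k i) = 0"
  shows "joint_form p s d x y
    = (\<Sum>i<s. \<Sum>k<p. (direct_part d x k i + carry_part d y k i)\<^sup>2)
      - (\<Sum>i<s. (\<Sum>k<p. direct_part d x k i + carry_part d y k i)\<^sup>2) / real p"
proof -
  have z: "(\<Sum>i<s. \<Sum>k<p. direct_part d x k i) = 0"
    "(\<Sum>i<s. \<Sum>k<p. carry_part d y k i) = 0"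
    using assms by (subst sum.swap, simp)+
  have "joint_form p s d x y =
     (\<Sum>i<s. \<Sum>k<p. direct_part d x k i * direct_part d x k i)
     + 2 * (\<Sum>i<s. \<Sum>k<p. direct_part d x k i * carry_part d y k i)
     + (\<Sum>i<s. \<Sum>k<p. carry_part d y k i * carry_part d y k i)
     - ((\<Sum>i<s. (\<Sum>k<p. direct_part d x k i) * (\<Sum>k<p. direct_part d x k i))
      + 2 * (\<Sum>i<s. (\<Sum>k<p. direct_part d x k i) * (\<Sum>k<p. carry_part d y k i))
      + (\<Sum>i<s. (\<Sum>k<p. carry_part d y k i) * (\<Sum>k<p. carry_part d y k i))) / real p"
    unfolding joint_form_def residual_form_def z
    by (simp add: assms) (simp add: add_divide_distrib mult.commute)
  also have "\<dots> = (\<Sum>i<s. \<Sum>k<p. (direct_part d x k i + carry_part d y k i)\<^sup>2)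
      - (\<Sum>i<s. (\<Sum>k<p. direct_part d x k i + carry_part d y k i)\<^sup>2) / real p"
  proof -
    have sq: "(a + b)\<^sup>2 = a * a + 2 * (a * b) + b * b" for a b :: real
      by (simp add: power2_eq_square algebra_simps)
    show ?thesis
      by (simp only: sum.distrib sq sum_distrib_left[symmetric])
  qed
  finally show ?thesis .
qed

section \<open>Counting identities of a uniform balanced design and its joint form on
  contrasts\<close>

locale ubrm_design =
  fixes t g :: nat and d :: design
  assumes design: "UBRMD t g d" and t_gt_1: "t > 1"
begin

lemma g_pos: "g > 0"
  using design by (simp add: UBRMD_def)

lemma d_less: "k < t \<Longrightarrow> i < g * t \<Longrightarrow> d k i < t"
  using design by (auto simp: UBRMD_def is_design_def)

text \<open>Uniformity only says that the frequencies agree. Their common value is found by applying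
  the identity to the constant function 1, and the same device is used in \<open>sum_periods\<close>
  and \<open>sum_successions\<close>.\<close>

lemma sum_subjects:
  assumes "k < t"
  shows "(\<Sum>i<g * t. f (d k i)) = real g * (\<Sum>a<t. f a)"
proof -
  define n where "n = card {i. i < g * t \<and> d k i = 0}"
  have c: "card {i. i < g * t \<and> d k i = a} = n" if "a < t" for a
  proof -
    have "uniform t (g * t) t d" using design by (simp add: UBRMD_def)
    hence *: "\<forall>a<t. \<forall>b<t. card {i. i < g * t \<and> d k i = a} = card {i. i < g * t \<and> d k i = b}"
      using assms unfolding uniform_def by blast
    show ?thesis using *[rule_format, OF that, of 0] t_gt_1 by (simp add: n_def)
  qed
  have *: "(\<Sum>i<g * t. f (d k i)) = real n * (\<Sum>a<t. f a)" for f :: "nat \<Rightarrow> real"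
  proof -
    have "(\<Sum>i<g * t. f (d k i)) = (\<Sum>a<t. of_nat (card {i \<in> {..<g * t}. d k i = a}) * f a)"
      by (rule sum_fun_comp[of "{..<g * t}" "{..<t}" "d k" f]) (use assms d_less in auto)
    also have "\<dots> = (\<Sum>a<t. real n * f a)"
      by (intro sum.cong) (use c in \<open>auto\<close>)
    finally show ?thesis by (simp add: sum_distrib_left)
  qed
  have "real n = real g" using *[of "\<lambda>_. 1"] t_gt_1 by simp
  with * show ?thesis by simp
qed

lemma sum_periods:
  assumes "i < g * t"
  shows "(\<Sum>k<t. f (d k i)) = (\<Sum>a<t. f a :: real)"
proof -
  define n where "n = card {k. k < t \<and> d k i = 0}"
  have c: "card {k. k < t \<and> d k i = a} = n" if "a < t" for a
  proof -
    have "uniform t (g * t) t d" using design by (simp add: UBRMD_def)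
    hence *: "\<forall>a<t. \<forall>b<t. card {k. k < t \<and> d k i = a} = card {k. k < t \<and> d k i = b}"
      using assms unfolding uniform_def by blast
    show ?thesis using *[rule_format, OF that, of 0] t_gt_1 by (simp add: n_def)
  qed
  have *: "(\<Sum>k<t. f (d k i)) = real n * (\<Sum>a<t. f a)" for f :: "nat \<Rightarrow> real"
  proof -
    have "(\<Sum>k<t. f (d k i)) = (\<Sum>a<t. of_nat (card {k \<in> {..<t}. d k i = a}) * f a)"
      by (rule sum_fun_comp[of "{..<t}" "{..<t}" "\<lambda>k. d k i" f]) (use assms d_less in auto)
    also have "\<dots> = (\<Sum>a<t. real n * f a)"
      by (intro sum.cong) (use c in \<open>auto\<close>)
    finally show ?thesis by (simp add: sum_distrib_left)
  qed
  have "real n = 1" using *[of "\<lambda>_. 1"] t_gt_1 by simp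
  with * show ?thesis by simp
qed

lemma sum_successions:
  "(\<Sum>i<g * t. \<Sum>k<t - 1. F (d k i) (d (Suc k) i))
    = real g * ((\<Sum>a<t. \<Sum>b<t. F a b) - (\<Sum>a<t. F a a))"
proof -
  obtain l where l: "\<And>a b. a < t \<Longrightarrow> b < t \<Longrightarrow>
      precedence_count t (g * t) d a b = (if a = b then 0 else l)"
    using design unfolding UBRMD_def balanced_def by blast
  let ?Z = "{..<g * t} \<times> {..<t - 1}"
  let ?h = "\<lambda>(i, k). (d k i, d (Suc k) i)"
  have cnt: "card {z \<in> ?Z. ?h z = (a, b)} = precedence_count t (g * t) d a b" for a b
    unfolding precedence_count_def
    by (rule bij_betw_same_card[of prod.swap]) (auto simp: bij_betw_def inj_on_def image_iff)
  have *: "(\<Sum>i<g * t. \<Sum>k<t - 1. F (d k i) (d (Suc k) i))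
      = real l * ((\<Sum>a<t. \<Sum>b<t. F a b) - (\<Sum>a<t. F a a))" for F :: "nat \<Rightarrow> nat \<Rightarrow> real"
  proof -
    have "(\<Sum>i<g * t. \<Sum>k<t - 1. F (d k i) (d (Suc k) i)) = (\<Sum>z\<in>?Z. (\<lambda>(a, b). F a b) (?h z))"
      by (simp add: sum.cartesian_product case_prod_unfold)
    also have "\<dots> = (\<Sum>z\<in>{..<t} \<times> {..<t}. of_nat (card {z' \<in> ?Z. ?h z' = z}) * (\<lambda>(a, b). F a b) z)"
      by (rule sum_fun_comp[of ?Z "{..<t} \<times> {..<t}" ?h]) (auto intro!: d_less)
    also have "\<dots> = (\<Sum>a<t. \<Sum>b<t. real (precedence_count t (g * t) d a b) * F a b)"
      by (subst sum.cartesian_product) (intro sum.cong refl, simp only: split_paired_all prod.case cnt)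
    also have "\<dots> = (\<Sum>a<t. \<Sum>b<t. real l * F a b - (if a = b then real l * F a a else 0))"
      by (intro sum.cong refl) (auto simp: l)
    also have "\<dots> = real l * ((\<Sum>a<t. \<Sum>b<t. F a b) - (\<Sum>a<t. F a a))"
      by (simp add: sum_subtractf sum.delta right_diff_distrib sum_distrib_left)
    finally show ?thesis .
  qed
  \<comment> \<open>All successions are counted twice: g * t subjects with t - 1 successions each,
    against l for each of the t * (t - 1) ordered pairs of distinct treatments.\<close>
  have "real g * real t * real (t - 1) = real l * (real t * real t - real t)"
    using *[of "\<lambda>_ _. 1"] by (simp add: mult_ac)
  hence "real g * (real t * (real t - 1)) = real l * (real t * (real t - 1))"
    using t_gt_1 by (simp add: of_nat_diff algebra_simps)
  hence "real l = real g" using t_gt_1 by simp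
  with * show ?thesis by simp
qed

lemma sum_direct_part:
  "k < t \<Longrightarrow> (\<Sum>i<g * t. direct_part d x k i) = real g * (\<Sum>a<t. x a)"
  by (simp add: direct_part_def sum_subjects[where f = x])

lemma sum_carry_part:
  "k < t \<Longrightarrow> (\<Sum>i<g * t. carry_part d y k i) = (if k = 0 then 0 else real g * (\<Sum>a<t. y a))"
  by (simp add: carry_part_def sum_subjects[where f = y])

text \<open>
  Both effects are contrasts, so every period total vanishes, and a subject total equals minus
  the total over the treatments that the subject misses.
\<close>

lemma joint_form_contrasts:
  assumes "m < t" and x: "(\<Sum>a<t. x a) = 0" and y: "(\<Sum>a<t. y a) = 0"
  defines "q \<equiv> t - m"
  shows "joint_form q (g * t) d x y =
      real g * real q * (\<Sum>a<t. (x a)\<^sup>2) + real g * (real q - 1) * (\<Sum>a<t. (y a)\<^sup>2)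
      - 2 * real g * (\<Sum>a<t. x a * y a)
      - 2 * (\<Sum>i<g * t. \<Sum>k\<in>{q - 1..<t - 1}. y (d k i) * x (d (Suc k) i))
      - (\<Sum>i<g * t. ((\<Sum>k\<in>{q..<t}. x (d k i)) + (\<Sum>k\<in>{q - 1..<t}. y (d k i)))\<^sup>2) / real q"
proof -
  let ?s = "g * t"
  have q: "0 < q" "q \<le> t" using assms by auto
  have split_first: "(\<Sum>k<q. f k) = f 0 + (\<Sum>k<q - 1. f (Suc k))" for f :: "nat \<Rightarrow> real"
    using q sum.lessThan_Suc_shift[of f "q - 1"] by simp
  have split_last: "(\<Sum>k<n. f k) = (\<Sum>k<l. f k) - (\<Sum>k\<in>{n..<l}. f k)"
    if "n \<le> l" for f :: "nat \<Rightarrow> real" and n l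
    using sum.atLeastLessThan_concat[of 0 n l f] that by (simp add: lessThan_atLeast0)
  have x0: "(\<Sum>i<?s. direct_part d x k i) = 0" if "k < q" for k
    using that q x by (simp add: sum_direct_part)
  have y0: "(\<Sum>i<?s. carry_part d y k i) = 0" if "k < q" for k
    using that q y by (simp add: sum_carry_part)
  have total: "(\<Sum>k<q. direct_part d x k i + carry_part d y k i)
      = - ((\<Sum>k\<in>{q..<t}. x (d k i)) + (\<Sum>k\<in>{q - 1..<t}. y (d k i)))" if "i < ?s" for i
  proof -
    have "(\<Sum>k<q. direct_part d x k i) = - (\<Sum>k\<in>{q..<t}. x (d k i))"
      using split_last[of q t "\<lambda>k. x (d k i)"] q x sum_periods[OF that, of x]
      by (simp add: direct_part_def)
    \<comment> \<open>The treatment of the last observed period has no observed carry-over, so the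
      carry-over total misses m + 1 treatments where the direct total misses m.\<close>
    moreover have "(\<Sum>k<q. carry_part d y k i) = (\<Sum>k<q - 1. y (d k i))"
      by (subst split_first) (simp add: carry_part_def)
    moreover have "\<dots> = - (\<Sum>k\<in>{q - 1..<t}. y (d k i))"
      using split_last[of "q - 1" t "\<lambda>k. y (d k i)"] q y sum_periods[OF that, of y] by simp
    ultimately show ?thesis by (simp add: sum.distrib)
  qed
  have xx: "(\<Sum>i<?s. \<Sum>k<q. (direct_part d x k i)\<^sup>2) = real g * real q * (\<Sum>a<t. (x a)\<^sup>2)"
    using q by (subst sum.swap)
      (simp add: direct_part_def sum_subjects[where f = "\<lambda>a. (x a)\<^sup>2"])
  have yy: "(\<Sum>i<?s. \<Sum>k<q. (carry_part d y k i)\<^sup>2) = real g * (real q - 1) * (\<Sum>a<t. (y a)\<^sup>2)"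
    using q by (subst sum.swap, subst split_first)
      (simp add: carry_part_def sum_subjects[where f = "\<lambda>a. (y a)\<^sup>2"] of_nat_diff)
  \<comment> \<open>Balance governs the sum over all t - 1 successions of the full design. Since x
    sums to zero, only the excluded diagonal survives there, and the successions into lost periods
    are subtracted.\<close>
  have xy: "(\<Sum>i<?s. \<Sum>k<q. direct_part d x k i * carry_part d y k i)
      = - real g * (\<Sum>a<t. x a * y a)
        - (\<Sum>i<?s. \<Sum>k\<in>{q - 1..<t - 1}. y (d k i) * x (d (Suc k) i))"
  proof -
    have "(\<Sum>i<?s. \<Sum>k<q. direct_part d x k i * carry_part d y k i)
        = (\<Sum>i<?s. \<Sum>k<q - 1. y (d k i) * x (d (Suc k) i))"
      by (subst split_first) (simp add: carry_part_def direct_part_def mult.commute)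
    also have "\<dots> = (\<Sum>i<?s. \<Sum>k<t - 1. y (d k i) * x (d (Suc k) i))
        - (\<Sum>i<?s. \<Sum>k\<in>{q - 1..<t - 1}. y (d k i) * x (d (Suc k) i))"
      using q by (subst split_last[of "q - 1" "t - 1"]) (auto simp: sum_subtractf)
    also have "(\<Sum>i<?s. \<Sum>k<t - 1. y (d k i) * x (d (Suc k) i))
        = real g * ((\<Sum>a<t. \<Sum>b<t. y a * x b) - (\<Sum>a<t. y a * x a))"
      by (rule sum_successions)
    also have "(\<Sum>a<t. \<Sum>b<t. y a * x b) = 0"
      using x by (simp flip: sum_distrib_left)
    finally show ?thesis by (simp add: mult.commute)
  qed
  have "joint_form q ?s d x y
      = (\<Sum>i<?s. \<Sum>k<q. (direct_part d x k i + carry_part d y k i)\<^sup>2)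
        - (\<Sum>i<?s. (\<Sum>k<q. direct_part d x k i + carry_part d y k i)\<^sup>2) / real q"
    by (rule joint_form_square[OF x0 y0])
  also have "(\<Sum>i<?s. (\<Sum>k<q. direct_part d x k i + carry_part d y k i)\<^sup>2)
      = (\<Sum>i<?s. ((\<Sum>k\<in>{q..<t}. x (d k i)) + (\<Sum>k\<in>{q - 1..<t}. y (d k i)))\<^sup>2)"
    using total by (intro sum.cong refl) (simp only: lessThan_iff power2_minus)
  also have "(\<Sum>i<?s. \<Sum>k<q. (direct_part d x k i + carry_part d y k i)\<^sup>2)
      = (\<Sum>i<?s. \<Sum>k<q. (direct_part d x k i)\<^sup>2)
        + 2 * (\<Sum>i<?s. \<Sum>k<q. direct_part d x k i * carry_part d y k i)
        + (\<Sum>i<?s. \<Sum>k<q. (carry_part d y k i)\<^sup>2)"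
  proof -
    have sq: "(a + b)\<^sup>2 = a\<^sup>2 + 2 * (a * b) + b\<^sup>2" for a b :: real
      by (simp add: power2_eq_square algebra_simps)
    show ?thesis
      by (simp only: sum.distrib sq sum_distrib_left[symmetric])
  qed
  finally show ?thesis unfolding xx yy xy by (simp add: algebra_simps)
qed

text \<open>Cauchy-Schwarz within each subject. It serves the case where \<open>theta_L t m\<close>
  is not positive.\<close>

lemma joint_form_nonneg:
  assumes "m < t" and "(\<Sum>a<t. x a) = 0" and "(\<Sum>a<t. y a) = 0"
  shows "joint_form (t - m) (g * t) d x y \<ge> 0"
proof -
  let ?w = "\<lambda>k i. direct_part d x k i + carry_part d y k i"
  have "(\<Sum>i<g * t. (\<Sum>k<t - m. ?w k i)\<^sup>2) \<le> (\<Sum>i<g * t. real (t - m) * (\<Sum>k<t - m. (?w k i)\<^sup>2))"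
    by (intro sum_mono order_trans[OF sum_power2_le]) simp
  moreover have "joint_form (t - m) (g * t) d x y = (\<Sum>i<g * t. \<Sum>k<t - m. (?w k i)\<^sup>2)
      - (\<Sum>i<g * t. (\<Sum>k<t - m. ?w k i)\<^sup>2) / real (t - m)"
    by (rule joint_form_square) (use assms in \<open>simp_all add: sum_direct_part sum_carry_part\<close>)
  ultimately show ?thesis
    using assms(1) by (simp add: sum_distrib_left[symmetric] divide_le_eq mult.commute del: of_nat_diff)
qed

section \<open>Estimates for the lost periods and bounds for the joint form\<close>

lemma sum_subjects_periods:
  assumes "K \<subseteq> {..<t}"
  shows "(\<Sum>i<g * t. \<Sum>k\<in>K. f (d k i)) = real g * real (card K) * (\<Sum>a<t. f a)"
  using assms by (subst sum.swap) (simp add: sum_subjects[where f = f] subset_iff)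

text \<open>Products over lost successions are not fixed by the design parameters, but the squares
  are: predecessors and successors each run through m full periods, where uniformity gives exact
  sums.\<close>

lemma sum_lost_successions_le:
  assumes "m < t" "c > 0"
  shows "2 * (\<Sum>i<g * t. \<Sum>k\<in>{t - m - 1..<t - 1}. y (d k i) * x (d (Suc k) i))
    \<le> real g * real m * ((\<Sum>a<t. (x a)\<^sup>2) / c + c * (\<Sum>a<t. (y a)\<^sup>2))"
proof -
  let ?K = "{t - m - 1..<t - 1}"
  have "2 * (\<Sum>i<g * t. \<Sum>k\<in>?K. y (d k i) * x (d (Suc k) i))
      \<le> (\<Sum>i<g * t. \<Sum>k\<in>?K. (x (d (Suc k) i))\<^sup>2 / c + c * (y (d k i))\<^sup>2)"
    unfolding sum_distrib_left using two_mult_le[OF assms(2)]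
    by (intro sum_mono) (metis mult.commute)
  also have "\<dots> = (\<Sum>i<g * t. \<Sum>k\<in>?K. (x (d (Suc k) i))\<^sup>2) / c
      + c * (\<Sum>i<g * t. \<Sum>k\<in>?K. (y (d k i))\<^sup>2)"
    by (simp add: sum.distrib sum_divide_distrib sum_distrib_left)
  also have "(\<Sum>i<g * t. \<Sum>k\<in>?K. (x (d (Suc k) i))\<^sup>2)
      = (\<Sum>i<g * t. \<Sum>k\<in>Suc ` ?K. (x (d k i))\<^sup>2)"
    by (subst sum.reindex) simp_all
  also have "\<dots> = real g * real (card (Suc ` ?K)) * (\<Sum>a<t. (x a)\<^sup>2)"
    by (rule sum_subjects_periods) auto
  also have "(\<Sum>i<g * t. \<Sum>k\<in>?K. (y (d k i))\<^sup>2) = real g * real (card ?K) * (\<Sum>a<t. (y a)\<^sup>2)"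
    by (rule sum_subjects_periods) auto
  also have "card ?K = m" using assms by simp
  also have "card (Suc ` ?K) = m" using assms by (subst card_image) simp_all
  finally show ?thesis by (simp add: algebra_simps)
qed

lemma sum_missing_square_le:
  assumes "n \<le> t"
  shows "(\<Sum>i<g * t. (\<Sum>k\<in>{t - n..<t}. x (d k i))\<^sup>2) \<le> real g * (real n)\<^sup>2 * (\<Sum>a<t. (x a)\<^sup>2)"
proof -
  let ?K = "{t - n..<t}"
  have "(\<Sum>i<g * t. (\<Sum>k\<in>?K. x (d k i))\<^sup>2)
      \<le> (\<Sum>i<g * t. real (card ?K) * (\<Sum>k\<in>?K. (x (d k i))\<^sup>2))"
    by (intro sum_mono sum_power2_le)
  also have "\<dots> = real (card ?K) * (\<Sum>i<g * t. \<Sum>k\<in>?K. (x (d k i))\<^sup>2)"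
    by (simp add: sum_distrib_left)
  also have "(\<Sum>i<g * t. \<Sum>k\<in>?K. (x (d k i))\<^sup>2) = real g * real (card ?K) * (\<Sum>a<t. (x a)\<^sup>2)"
    by (rule sum_subjects_periods) auto
  finally show ?thesis using assms by (simp add: power2_eq_square algebra_simps)
qed

lemma sum_missing_product_le:
  assumes "m \<le> t" "n \<le> t" "c > 0"
  shows "(\<Sum>i<g * t. 2 * ((\<Sum>k\<in>{t - m..<t}. x (d k i)) * (\<Sum>k\<in>{t - n..<t}. y (d k i))))
    \<le> real g * real m * real n * ((\<Sum>a<t. (x a)\<^sup>2) / c + c * (\<Sum>a<t. (y a)\<^sup>2))"
proof -
  let ?K = "{t - m..<t}" and ?L = "{t - n..<t}"
  have "(\<Sum>i<g * t. 2 * ((\<Sum>k\<in>?K. x (d k i)) * (\<Sum>k\<in>?L. y (d k i))))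
      \<le> (\<Sum>i<g * t. real (card ?L) / c * (\<Sum>k\<in>?K. (x (d k i))\<^sup>2)
           + real (card ?K) * c * (\<Sum>k\<in>?L. (y (d k i))\<^sup>2))"
    by (intro sum_mono two_sum_mult_le assms)
  also have "\<dots> = real (card ?L) / c * (\<Sum>i<g * t. \<Sum>k\<in>?K. (x (d k i))\<^sup>2)
      + real (card ?K) * c * (\<Sum>i<g * t. \<Sum>k\<in>?L. (y (d k i))\<^sup>2)"
    by (simp add: sum.distrib sum_distrib_left)
  also have "(\<Sum>i<g * t. \<Sum>k\<in>?K. (x (d k i))\<^sup>2) = real g * real (card ?K) * (\<Sum>a<t. (x a)\<^sup>2)"
    by (rule sum_subjects_periods) auto
  also have "(\<Sum>i<g * t. \<Sum>k\<in>?L. (y (d k i))\<^sup>2) = real g * real (card ?L) * (\<Sum>a<t. (y a)\<^sup>2)"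
    by (rule sum_subjects_periods) auto
  finally show ?thesis using assms by (simp add: algebra_simps)
qed

text \<open>One weight c serves all three cross terms. Up to the factor g, their coefficients 1, m
  and m(m + 1)/q add up to t(m + 1)/q because t = q + m. In the same way q - m^2/q = t(t - 2m)/q is
  the coefficient of X, and q - 1 - (m + 1)^2/q = \<open>theta_denom t m\<close> / q that of
  Y.\<close>

lemma joint_form_ge:
  assumes m: "m < t" and "(\<Sum>a<t. x a) = 0" and "(\<Sum>a<t. y a) = 0" and c: "c > 0"
  defines "q \<equiv> real t - real m"
  defines "X \<equiv> \<Sum>a<t. (x a)\<^sup>2" and "Y \<equiv> \<Sum>a<t. (y a)\<^sup>2"
  shows "joint_form (t - m) (g * t) d x y \<ge>
    real g * real t * (real t - 2 * real m) / q * X + g * theta_denom t m / q * Y - real g * real t * (real m + 1) / q * (X / c + c * Y)"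
proof -
  let ?u = "\<lambda>i. \<Sum>k\<in>{t - m..<t}. x (d k i)" and ?v = "\<lambda>i. \<Sum>k\<in>{t - m - 1..<t}. y (d k i)"
  have q: "q > 0" "real (t - m) = q" using m by (auto simp: q_def)
  have xy: "2 * (\<Sum>a<t. x a * y a) \<le> X / c + c * Y"
    unfolding X_def Y_def sum_distrib_left sum_divide_distrib sum.distrib[symmetric]
    by (intro sum_mono two_mult_le c)
  have "(\<Sum>i<g * t. (?u i + ?v i)\<^sup>2)
      = (\<Sum>i<g * t. (?u i)\<^sup>2) + (\<Sum>i<g * t. 2 * (?u i * ?v i)) + (\<Sum>i<g * t. (?v i)\<^sup>2)"
    by (simp add: power2_sum sum.distrib algebra_simps)
  also have "\<dots> \<le> g * (real m)\<^sup>2 * X + real g * real m * (real m + 1) * (X / c + c * Y) + g * (real m + 1)\<^sup>2 * Y"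
    using m sum_missing_square_le[of m x] sum_missing_square_le[of "m + 1" y]
      sum_missing_product_le[of m "m + 1" c x y] c
    by (intro add_mono) (simp_all add: X_def Y_def algebra_simps)
  finally have sq: "(\<Sum>i<g * t. (?u i + ?v i)\<^sup>2) / q \<le>
      (g * (real m)\<^sup>2 * X + real g * real m * (real m + 1) * (X / c + c * Y) + g * (real m + 1)\<^sup>2 * Y) / q"
    using q by (simp add: divide_right_mono)
  have "joint_form (t - m) (g * t) d x y \<ge>
      g * q * X + g * (q - 1) * Y - g * (X / c + c * Y) - real g * real m * (X / c + c * Y)
      - (g * (real m)\<^sup>2 * X + real g * real m * (real m + 1) * (X / c + c * Y) + g * (real m + 1)\<^sup>2 * Y) / q"
    using joint_form_contrasts[OF assms(1-3)] sum_lost_successions_le[OF m c, of y x]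
      mult_left_mono[OF xy, of "real g"] sq
    by (simp add: q X_def Y_def)
  also have "g * q * X + g * (q - 1) * Y - g * (X / c + c * Y) - real g * real m * (X / c + c * Y)
      - (g * (real m)\<^sup>2 * X + real g * real m * (real m + 1) * (X / c + c * Y) + g * (real m + 1)\<^sup>2 * Y) / q
    = real g * real t * (real t - 2 * real m) / q * X + g * theta_denom t m / q * Y - real g * real t * (real m + 1) / q * (X / c + c * Y)"
  proof -
    have t: "real t = q + real m" by (simp add: q_def)
    define Z where "Z = X / c + c * Y"
    show ?thesis unfolding Z_def[symmetric] theta_denom_def t
      using q(1) by (simp add: field_simps power2_eq_square)
  qed
  finally show ?thesis by simp
qed

lemma joint_form_ge_theta_L:
  assumes "m < t" "theta_denom t m > 0" "(\<Sum>a<t. x a) = 0" "(\<Sum>a<t. y a) = 0"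
  shows "joint_form (t - m) (g * t) d x y \<ge> g * theta_L t m * (\<Sum>a<t. (x a)\<^sup>2)"
proof -
  define q where "q = real t - real m"
  define D where "D = theta_denom t m"
  define X where "X = (\<Sum>a<t. (x a)\<^sup>2)"
  define Y where "Y = (\<Sum>a<t. (y a)\<^sup>2)"
  \<comment> \<open>The weight for which c * t * (m + 1) = D, so that the Y terms cancel; what
    remains of the coefficient of X is g times \<open>theta_L t m\<close>.\<close>
  define c where "c = D / (real t * (real m + 1))"
  have pos: "q > 0" "D > 0" "real t > 0" "real g > 0"
    using assms g_pos by (auto simp: q_def D_def)
  have "c > 0" unfolding c_def using pos by (intro divide_pos_pos mult_pos_pos) simp_all
  from joint_form_ge[OF assms(1,3,4) this] have
    "joint_form (t - m) (g * t) d x y \<ge>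
      real g * real t * (real t - 2 * real m) / q * X + g * D / q * Y - real g * real t * (real m + 1) / q * (X / c + c * Y)"
    by (simp add: q_def D_def X_def Y_def)
  also have "real g * real t * (real t - 2 * real m) / q * X + g * D / q * Y - real g * real t * (real m + 1) / q * (X / c + c * Y)
      = g * theta_L t m * X"
  proof -
    define e where "e = real m + 1"
    have "e > 0" by (simp add: e_def)
    thus ?thesis
      unfolding theta_L_def q_def[symmetric] D_def[symmetric] c_def e_def[symmetric]
      using pos by (simp add: field_simps power2_eq_square)
  qed
  finally show ?thesis by (simp add: X_def)
qed

text \<open>With x = 0 no cross terms arise and only the missed carry-over totals are estimated. The
  left side is the form of \<open>C22\<close>, so this is the positivity that the Schur complement
  requires.\<close>

lemma joint_form_carry_ge:
  assumes m: "m < t" and y: "(\<Sum>a<t. y a) = 0"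
  shows "joint_form (t - m) (g * t) d (\<lambda>_. 0) y
    \<ge> g * theta_denom t m / (real t - real m) * (\<Sum>a<t. (y a)\<^sup>2)"
proof -
  define q where "q = real t - real m"
  define Y where "Y = (\<Sum>a<t. (y a)\<^sup>2)"
  have q: "q > 0" "real (t - m) = q" using m by (auto simp: q_def)
  have "(\<Sum>i<g * t. (\<Sum>k\<in>{t - m - 1..<t}. y (d k i))\<^sup>2) / q \<le> g * (real m + 1)\<^sup>2 * Y / q"
    using q m sum_missing_square_le[of "m + 1" y]
    by (intro divide_right_mono) (simp_all add: Y_def algebra_simps)
  hence "joint_form (t - m) (g * t) d (\<lambda>_. 0) y \<ge> g * (q - 1) * Y - g * (real m + 1)\<^sup>2 * Y / q"
    using joint_form_contrasts[OF m _ y, of "\<lambda>_. 0"] by (simp add: q Y_def)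
  also have "g * (q - 1) * Y - g * (real m + 1)\<^sup>2 * Y / q = g * theta_denom t m / q * Y"
  proof -
    have t: "real t = q + real m" by (simp add: q_def)
    show ?thesis unfolding theta_denom_def t
      using q(1) by (simp add: field_simps power2_eq_square)
  qed
  finally show ?thesis by (simp add: q_def Y_def)
qed

text \<open>The trial value y = 0. Its only purpose is a finite upper bound on the eigenvalues,
  which makes the trace for the truncated design positive and hence a legitimate
  denominator.\<close>

lemma joint_form_direct_le:
  fixes x :: "nat \<Rightarrow> real"
  assumes m: "m < t" and x: "(\<Sum>a<t. x a) = 0"
  shows "joint_form (t - m) (g * t) d x (\<lambda>_. 0) \<le> real g * real (t - m) * (\<Sum>a<t. (x a)\<^sup>2)"
proof -
  have "0 \<le> (\<Sum>i<g * t. (\<Sum>k\<in>{t - m..<t}. x (d k i))\<^sup>2) / real (t - m)"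
    by (intro divide_nonneg_nonneg sum_nonneg) simp_all
  thus ?thesis
    using joint_form_contrasts[OF m x, of "\<lambda>_. 0"] by (simp del: of_nat_diff)
qed

text \<open>Without dropout, every subject misses exactly one carry-over treatment, so the form
  equals g(t X - 2 x'y + (D/t) Y) with D = \<open>theta_denom t 0\<close>. It is minimal at y =
  (t/D) x, which explains the second argument.\<close>

lemma joint_form_plan:
  assumes x: "(\<Sum>a<t. x a) = 0" and D: "theta_denom t 0 > 0"
  shows "joint_form t (g * t) d x (\<lambda>a. t / theta_denom t 0 * x a) = g * theta_L t 0 * (\<Sum>a<t. (x a)\<^sup>2)"
proof -
  define D where "D = theta_denom t 0"
  define X where "X = (\<Sum>a<t. (x a)\<^sup>2)"
  define e where "e = t / D"
  have x': "(\<Sum>a<t. e * x a) = 0" using x by (simp only: sum_distrib_left[symmetric] mult_zero_right)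
  have sums: "(\<Sum>a<t. (e * x a)\<^sup>2) = e\<^sup>2 * X" "(\<Sum>a<t. x a * (e * x a)) = e * X"
    by (simp_all add: X_def sum_distrib_left power_mult_distrib power2_eq_square mult_ac)
  have "joint_form t (g * t) d x (\<lambda>a. e * x a) =
      g * t * X + g * (real t - 1) * (e\<^sup>2 * X) - 2 * g * (e * X)
      - (\<Sum>i<g * t. (\<Sum>k\<in>{t - 1..<t}. e * x (d k i))\<^sup>2) / t"
    using joint_form_contrasts[of 0, OF _ x x'] t_gt_1 unfolding sums X_def[symmetric] by simp
  also have "(\<Sum>i<g * t. (\<Sum>k\<in>{t - 1..<t}. e * x (d k i))\<^sup>2)
      = (\<Sum>i<g * t. (e * x (d (t - 1) i))\<^sup>2)"
  proof -
    have "{t - 1..<t} = {t - 1}" using t_gt_1 by auto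
    thus ?thesis by simp
  qed
  also have "\<dots> = g * (e\<^sup>2 * X)"
    using t_gt_1 sum_subjects[of "t - 1" "\<lambda>a. (e * x a)\<^sup>2"]
    by (simp add: sums)
  also have "g * t * X + g * (real t - 1) * (e\<^sup>2 * X) - 2 * g * (e * X)
      - g * (e\<^sup>2 * X) / t = g * theta_L t 0 * X"
  proof -
    have "(real t - 1) * t - 1 = D"
      by (simp add: D_def theta_denom_def power2_eq_square algebra_simps)
    hence "real t - 1 - 1 / t = D / t" using t_gt_1 by (simp add: field_simps)
    moreover have "g * t * X + g * (real t - 1) * (e\<^sup>2 * X) - 2 * g * (e * X)
        - g * (e\<^sup>2 * X) / t
      = g * X * (t - 2 * e + e\<^sup>2 * (real t - 1 - 1 / t))"
      by (simp add: algebra_simps)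
    ultimately have "g * t * X + g * (real t - 1) * (e\<^sup>2 * X) - 2 * g * (e * X)
        - g * (e\<^sup>2 * X) / t
      = g * X * (t - 2 * e + e\<^sup>2 * (D / t))" by simp
    also have "\<dots> = g * theta_L t 0 * X"
      unfolding theta_L_def D_def[symmetric]
      using D t_gt_1 by (simp add: D_def[symmetric] e_def field_simps power2_eq_square)
    finally show ?thesis .
  qed
  finally show ?thesis by (simp add: D_def X_def e_def)
qed

end

subsection \<open>Contrasts and generalized inverses\<close>

definition one_vec :: "nat \<Rightarrow> real vec" where
  "one_vec n = vec n (\<lambda>_. 1)"

lemma one_vec_carrier [simp]: "one_vec n \<in> carrier_vec n"
  by (simp add: one_vec_def)

lemma scalar_prod_one_vec: "x \<in> carrier_vec n \<Longrightarrow> x \<bullet> one_vec n = (\<Sum>a<n. x $ a)"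
  by (simp add: scalar_prod_def one_vec_def lessThan_atLeast0)

lemma scalar_prod_self: "x \<in> carrier_vec n \<Longrightarrow> x \<bullet> x = (\<Sum>a<n. (x $ a)\<^sup>2)" for x :: "real vec"
  by (simp add: scalar_prod_def lessThan_atLeast0 power2_eq_square)

lemma scalar_prod_self_nonneg: "x \<in> carrier_vec n \<Longrightarrow> x \<bullet> x \<ge> 0" for x :: "real vec"
  by (simp add: scalar_prod_self[of x n] sum_nonneg)

lemma scalar_prod_self_eq_0:
  fixes x :: "real vec"
  assumes "x \<in> carrier_vec n" "x \<bullet> x = 0"
  shows "x = 0\<^sub>v n"
proof -
  have "\<forall>a\<in>{..<n}. (x $ a)\<^sup>2 = 0"
    using assms by (subst sum_nonneg_eq_0_iff[symmetric]) (simp_all add: scalar_prod_self[of x n])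
  thus ?thesis using assms(1) by (intro eq_vecI) auto
qed

lemma symmetric_mat_scalar_prod:
  fixes C :: "real mat"
  assumes "C \<in> carrier_mat n n" "transpose_mat C = C" "x \<in> carrier_vec n" "y \<in> carrier_vec n"
  shows "x \<bullet> (C *\<^sub>v y) = (C *\<^sub>v x) \<bullet> y"
  using transpose_vec_mult_scalar[OF assms(1,4,3)] assms(2) by simp

lemma contrast_decomposition:
  assumes "n > 0" "v \<in> carrier_vec n"
  obtains c a where "c \<in> carrier_vec n" "c \<bullet> one_vec n = 0" "v = c + a \<cdot>\<^sub>v one_vec n"
proof
  let ?a = "(\<Sum>i<n. v $ i) / n"
  let ?c = "vec n (\<lambda>i. v $ i - ?a)"
  show "?c \<in> carrier_vec n" by simp
  thus "?c \<bullet> one_vec n = 0"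
    using assms by (simp add: scalar_prod_one_vec sum_subtractf)
  show "v = ?c + ?a \<cdot>\<^sub>v one_vec n"
    using assms by (intro eq_vecI) (simp_all add: one_vec_def)
qed

lemma mult_add_one_vec:
  assumes "C \<in> carrier_mat n n" "C *\<^sub>v one_vec n = 0\<^sub>v n" "c \<in> carrier_vec n"
  shows "C *\<^sub>v (c + a \<cdot>\<^sub>v one_vec n) = C *\<^sub>v c"
proof -
  have "a \<cdot>\<^sub>v 0\<^sub>v n = 0\<^sub>v n" by (intro eq_vecI) auto
  thus ?thesis
    using assms mult_mat_vec_carrier[OF assms(1,3)]
    by (simp add: mult_add_distrib_mat_vec[of _ n n] mult_mat_vec[of _ n n])
qed

section \<open>Existence and uniqueness of the Moore-Penrose inverse of a symmetric matrix\<close>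

lemma vector_space_real_fun: "vector_space (\<lambda>(a :: real) (f :: nat \<Rightarrow> real) i. a * f i)"
  by unfold_locales (simp_all add: fun_eq_iff distrib_left distrib_right)

text \<open>A linear map f has a linear right inverse h on its range, so that f h f = f, and G is
  the matrix of h. Vectors are modelled as functions on all of \<open>nat\<close> to have a whole
  type as vector space; f ignores the coordinates from n on and returns zero there.\<close>

lemma generalized_inverse_exists:
  fixes A :: "real mat"
  assumes A: "A \<in> carrier_mat n n"
  shows "\<exists>G. generalized_inverse A G"
proof -
  let ?sc = "\<lambda>(a :: real) (f :: nat \<Rightarrow> real) i. a * f i"
  define f :: "(nat \<Rightarrow> real) \<Rightarrow> nat \<Rightarrow> real"
    where "f v i = (if i < n then \<Sum>l<n. A $$ (i, l) * v l else 0)" for v i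
  define e :: "nat \<Rightarrow> nat \<Rightarrow> real" where "e j i = (if i = j then 1 else 0)" for i j
  have pair: "vector_space_pair ?sc ?sc"
    by (intro vector_space_pair.intro vector_space_real_fun)
  have "module_hom ?sc ?sc f"
  proof (intro module_hom.intro module_hom_axioms.intro)
    show "Modules.module ?sc" "Modules.module ?sc"
      using vector_space_real_fun by (simp_all add: module_iff_vector_space)
    show "f (u + v) = f u + f v" for u v
      by (simp add: f_def fun_eq_iff sum.distrib distrib_left)
    show "f (?sc c v) = ?sc c (f v)" for c v
      by (simp add: f_def fun_eq_iff sum_distrib_left mult_ac)
  qed
  hence "Vector_Spaces.linear ?sc ?sc f"
    using vector_space_real_fun by (simp add: linear_iff_module_hom)
  from vector_space_pair.linear_exists_right_inverse_on[OF pair this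
      module.subspace_UNIV[OF vector_space_real_fun[folded module_iff_vector_space]]]
  obtain h where h: "Vector_Spaces.linear ?sc ?sc h" "\<And>v. f (h (f v)) = f v"
    by auto
  have hom: "module_hom ?sc ?sc h"
    using h(1) by (simp add: linear_iff_module_hom)
  \<comment> \<open>Cutting \<open>h (e k)\<close> down to its first n coordinates is harmless,
    since f reads no others.\<close>
  define G where "G = mat n n (\<lambda>(l, k). h (e k) l)"
  have fe: "f (e j) = (\<Sum>k<n. ?sc (A $$ (k, j)) (e k))" if "j < n" for j
  proof
    fix i
    have *: "(\<Sum>k<n. ?sc (A $$ (k, j)) (e k)) i = (\<Sum>k<n. A $$ (k, j) * e k i)"
      by (induction n) simp_all
    show "f (e j) i = (\<Sum>k<n. ?sc (A $$ (k, j)) (e k)) i"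
      using that unfolding * by (auto simp: f_def e_def if_distrib cong: if_cong)
  qed
  have hfe: "h (f (e j)) l = (\<Sum>k<n. A $$ (k, j) * h (e k) l)" if "j < n" for j l
  proof -
    have *: "(\<Sum>k<n. ?sc (A $$ (k, j)) (h (e k))) l = (\<Sum>k<n. A $$ (k, j) * h (e k) l)"
      by (induction n) simp_all
    have "h (f (e j)) = (\<Sum>k<n. ?sc (A $$ (k, j)) (h (e k)))"
      unfolding fe[OF that] module_hom.sum[OF hom] module_hom.scale[OF hom] ..
    thus ?thesis using * by simp
  qed
  have "A * G * A = A"
  proof (rule eq_matI)
    fix i j assume "i < dim_row A" "j < dim_col A"
    hence ij: "i < n" "j < n" using A by auto
    have "(A * (G * A)) $$ (i, j) = (\<Sum>l<n. A $$ (i, l) * (\<Sum>k<n. h (e k) l * A $$ (k, j)))"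
      using A ij by (simp add: G_def scalar_prod_def lessThan_atLeast0)
    also have "\<dots> = (\<Sum>l<n. A $$ (i, l) * h (f (e j)) l)"
      using ij by (simp add: hfe mult.commute)
    also have "\<dots> = f (h (f (e j))) i" using ij by (simp add: f_def)
    also have "\<dots> = A $$ (i, j)"
      using ij unfolding h(2) by (simp add: f_def e_def if_distrib cong: if_cong)
    finally show "(A * G * A) $$ (i, j) = A $$ (i, j)"
      using A by (simp add: G_def assoc_mult_mat[of _ n n _ n _ n])
  qed (use A in \<open>auto simp: G_def\<close>)
  moreover have "G \<in> carrier_mat n n" by (simp add: G_def)
  ultimately show ?thesis using A by (auto simp: generalized_inverse_def)
qed

text \<open>A symmetric real matrix has the same kernel as its square: if A(Av) = 0, then |Av|^2 =
  v'A(Av) = 0. This is applied to the difference of corresponding columns of M and N.\<close>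

lemma symmetric_mult_left_cancel:
  fixes A :: "real mat"
  assumes A: "A \<in> carrier_mat n n" "transpose_mat A = A"
    and M: "M \<in> carrier_mat n k" and N: "N \<in> carrier_mat n k"
    and eq: "A * (A * M) = A * (A * N)"
  shows "A * M = A * N"
proof (rule eq_matI)
  fix i j assume "i < dim_row (A * N)" "j < dim_col (A * N)"
  hence ij: "i < n" "j < k" using A N by auto
  let ?v = "col M j - col N j"
  have v: "col M j \<in> carrier_vec n" "col N j \<in> carrier_vec n" "?v \<in> carrier_vec n"
    using col_carrier_vec[OF ij(2) M] col_carrier_vec[OF ij(2) N] by simp_all
  have "col (A * (A * Z)) j = A *\<^sub>v (A *\<^sub>v col Z j)" if "Z \<in> carrier_mat n k" for Z
    using that A(1) ij
    by (simp add: col_mult2[of A n n "A * Z" k] col_mult2[of A n n Z k] mult_carrier_mat[OF A(1)] del: col_mult)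
  hence "A *\<^sub>v (A *\<^sub>v col M j) = A *\<^sub>v (A *\<^sub>v col N j)"
    using M N arg_cong[OF eq, of "\<lambda>Z. col Z j"] by metis
  hence "A *\<^sub>v (A *\<^sub>v ?v) = 0\<^sub>v n"
    using A v by (simp add: mult_minus_distrib_mat_vec[of _ n n])
  hence "(A *\<^sub>v ?v) \<bullet> (A *\<^sub>v ?v) = 0"
    using symmetric_mat_scalar_prod[OF A v(3), of "A *\<^sub>v ?v"] A v by simp
  hence "A *\<^sub>v ?v = 0\<^sub>v n"
    by (rule scalar_prod_self_eq_0[rotated]) (use A v in auto)
  hence "(A *\<^sub>v col M j - A *\<^sub>v col N j) $ i = 0"
    using A v ij by (simp add: mult_minus_distrib_mat_vec[of _ n n])
  thus "(A * M) $$ (i, j) = (A * N) $$ (i, j)"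
    using A M N ij by simp
qed (use assms in auto)

text \<open>Penrose's argument: \<open>A * X\<close> and \<open>A * Y\<close> are symmetric
  idempotents with the same range, hence equal, and similarly \<open>X * A = Y * A\<close>. Then X =
  XAX = XAY = YAY = Y.\<close>

lemma moore_penrose_unique:
  assumes A: "A \<in> carrier_mat n n" and X: "is_moore_penrose A X" and Y: "is_moore_penrose A Y"
  shows "X = Y"
proof -
  note [simp] = assoc_mult_mat[of _ n n _ n _ n] mult_carrier_mat[of _ n n _ n]
  have c [simp]: "A \<in> carrier_mat n n" "X \<in> carrier_mat n n" "Y \<in> carrier_mat n n"
    using assms by (auto simp: is_moore_penrose_def)
  have X': "A * (X * A) = A" "X * (A * X) = X" "transpose_mat (A * X) = A * X" "transpose_mat (X * A) = X * A"
    and Y': "A * (Y * A) = A" "Y * (A * Y) = Y" "transpose_mat (A * Y) = A * Y" "transpose_mat (Y * A) = Y * A"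
    using X Y by (auto simp: is_moore_penrose_def)
  have "A * X = transpose_mat ((A * Y) * (A * X))"
    using X'(3) arg_cong[OF Y'(1), of "\<lambda>M. M * X"] by simp
  also have "\<dots> = (A * X) * (A * Y)"
    by (subst transpose_mult[of _ n n _ n]) (simp_all add: X' Y' del: assoc_mult_mat)
  also have "\<dots> = A * (X * A) * Y" by simp
  finally have AX: "A * X = A * Y" by (simp only: X')
  have "X * A = transpose_mat ((X * A) * (Y * A))"
    using X'(4) Y'(1) by simp
  also have "\<dots> = (Y * A) * (X * A)"
    by (subst transpose_mult[of _ n n _ n]) (simp_all add: X' Y' del: assoc_mult_mat)
  also have "\<dots> = Y * (A * (X * A))" by simp
  finally have XA: "X * A = Y * A" by (simp only: X')
  have "X = X * (A * Y)" using X'(2) AX by simp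
  also have "\<dots> = (X * A) * Y" by simp
  also have "\<dots> = Y * (A * Y)" by (simp add: XA)
  finally show ?thesis by (simp only: Y')
qed

text \<open>With \<open>G\<close> a generalized inverse of \<open>A\<^sup>3\<close>, the Moore-Penrose inverse is \<open>A G A\<close>.\<close>

lemma moore_penrose_exists:
  fixes A :: "real mat"
  assumes A: "A \<in> carrier_mat n n" and sym: "transpose_mat A = A"
  shows "\<exists>X. is_moore_penrose A X"
proof -
  note [simp] = assoc_mult_mat[of _ n n _ n _ n] mult_carrier_mat[of _ n n _ n] transpose_mult[of _ n n _ n]
  obtain G where "generalized_inverse (A * (A * A)) G"
    using generalized_inverse_exists[of "A * (A * A)" n] A by auto
  hence G: "G \<in> carrier_mat n n" "A * (A * (A * (G * (A * (A * A))))) = A * (A * A)"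
    using A by (auto simp: generalized_inverse_def)
  note [simp] = A G(1) sym right_mult_one_mat[OF A]
  \<comment> \<open>The identity A^3 G A^3 = A^3 is now reduced to identities whose right side is A.
    Only left factors can be cancelled directly; since G need not be symmetric, right factors are
    cancelled after transposition, where G' appears.\<close>
  have l2: "A * (A * (G * (A * (A * A)))) = A * A"
    using symmetric_mult_left_cancel[OF A sym, of "A * (G * (A * (A * A)))" n A] G(2) by simp
  have l1: "A * (G * (A * (A * A))) = A"
    using symmetric_mult_left_cancel[OF A sym, of "G * (A * (A * A))" n "1\<^sub>m n"] l2 by simp
  have r0: "A * (A * (A * (G\<^sup>T * (A * (A * A))))) = A * (A * A)"
    using arg_cong[OF G(2), of transpose_mat] by simp
  have r2: "A * (A * (G\<^sup>T * (A * (A * A)))) = A * A"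
    using symmetric_mult_left_cancel[OF A sym, of "A * (G\<^sup>T * (A * (A * A)))" n A] r0 by simp
  have r1: "A * (G\<^sup>T * (A * (A * A))) = A"
    using symmetric_mult_left_cancel[OF A sym, of "G\<^sup>T * (A * (A * A))" n "1\<^sub>m n"] r2 by simp
  have r1': "A * (A * (A * (G * A))) = A"
    using arg_cong[OF r1, of transpose_mat] by simp
  have m: "A * (A * (G * (A * A))) = A"
  proof -
    have "A * (A * (A * (G\<^sup>T * (A * A)))) = A * A"
      using arg_cong[OF l2, of transpose_mat] by simp
    hence "A * (A * (G\<^sup>T * (A * A))) = A"
      using symmetric_mult_left_cancel[OF A sym, of "A * (G\<^sup>T * (A * A))" n "1\<^sub>m n"] by simp
    from arg_cong[OF this, of transpose_mat] show ?thesis by simp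
  qed
  define X where "X = A * (G * A)"
  have X: "X \<in> carrier_mat n n" by (simp add: X_def)
  define E where "E = A * X"
  define F where "F = X * A"
  have EF: "E \<in> carrier_mat n n" "F \<in> carrier_mat n n"
    "A * E = A" "E * A = A" "A * F = A" "F * A = A"
    by (simp_all add: E_def F_def X_def m l1 r1')
  \<comment> \<open>From these follow E'E = E and FF' = F. The left sides are Gram matrices, so E
    and F are symmetric, which gives the last two Penrose conditions.\<close>
  have "transpose_mat E * A = A" "A * transpose_mat F = A"
    using arg_cong[OF EF(3), of transpose_mat] arg_cong[OF EF(6), of transpose_mat] EF(1,2) by simp_all
  moreover have "transpose_mat E * E = transpose_mat E * A * X" "F * transpose_mat F = X * (A * transpose_mat F)"
    using X by (simp_all add: E_def F_def)
  ultimately have "transpose_mat E * E = E" "F * transpose_mat F = F"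
    by (simp_all only: E_def[symmetric] F_def[symmetric])
  hence "transpose_mat E = E" "transpose_mat F = F"
    using EF(1,2) transpose_mult[of "transpose_mat E" n n E n] transpose_mult[of F n n "transpose_mat F" n]
    by simp_all
  moreover have "A * X * A = A" "X * A * X = X"
    using m l1 r1' by (simp_all add: X_def)
  moreover have "X \<in> carrier_mat (dim_col A) (dim_row A)" using X carrier_matD[OF A] by simp
  ultimately have "is_moore_penrose A X"
    unfolding is_moore_penrose_def E_def F_def by blast
  thus ?thesis ..
qed

text \<open>The transpose of X satisfies the Penrose conditions for A as well, so uniqueness makes X
  symmetric. Transposing \<open>X * A\<close> then shows that X and A commute.\<close>

lemma moore_penrose_symmetric:
  fixes A :: "real mat"
  assumes A: "A \<in> carrier_mat n n" and sym: "transpose_mat A = A"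
  defines "X \<equiv> moore_penrose A"
  shows "X \<in> carrier_mat n n" "transpose_mat X = X" "X * A = A * X" "X * (A * X) = X"
    "A * (X * A) = A"
proof -
  have X: "is_moore_penrose A X"
    unfolding X_def moore_penrose_def
    using moore_penrose_exists[OF A sym] moore_penrose_unique[OF A] by (blast intro: theI)
  thus c: "X \<in> carrier_mat n n" using A by (auto simp: is_moore_penrose_def)
  note [simp] = assoc_mult_mat[of _ n n _ n _ n] mult_carrier_mat[of _ n n _ n] transpose_mult[of _ n n _ n] A c sym
  have eqs: "A * (X * A) = A" "X * (A * X) = X"
    "transpose_mat (A * X) = A * X" "transpose_mat (X * A) = X * A"
    using X by (simp_all add: is_moore_penrose_def)
  have "is_moore_penrose A (transpose_mat X)"
    using arg_cong[OF eqs(1), of transpose_mat] arg_cong[OF eqs(2), of transpose_mat] eqs(3,4)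
      carrier_matD[OF A] by (simp add: is_moore_penrose_def)
  thus t: "transpose_mat X = X" by (rule moore_penrose_unique[OF A _ X])
  show "X * A = A * X" using transpose_mult[OF c A] by (simp only: eqs(4) t sym)
  show "X * (A * X) = X" "A * (X * A) = A" by (rule eqs)+
qed

subsection \<open>Eigenvalue bounds on contrasts\<close>

text \<open>The contrast parts of the n unit vectors have squared lengths adding up to n - 1. This
  turns bounds for a form on contrasts into bounds for the trace, with the factor n - 1 otherwise
  obtained by counting eigenvalues.\<close>

lemma unit_vec_decomposition:
  assumes "i < n"
  defines "c \<equiv> unit_vec n i - (1 / real n) \<cdot>\<^sub>v one_vec n"
  shows "c \<in> carrier_vec n" "c \<bullet> one_vec n = 0" "c \<bullet> c = (real n - 1) / real n"
    "unit_vec n i = c + (1 / real n) \<cdot>\<^sub>v one_vec n"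
proof -
  show c: "c \<in> carrier_vec n" by (simp add: c_def)
  have c_nth: "c $ j = (if j = i then 1 else 0) - 1 / real n" if "j < n" for j
    using that assms by (simp add: c_def one_vec_def unit_vec_def)
  show "c \<bullet> one_vec n = 0"
    using assms(1) by (simp add: scalar_prod_one_vec[OF c] c_nth sum_subtractf)
  have "(c $ j)\<^sup>2 = (if j = i then 1 - 2 / real n else 0) + 1 / (real n)\<^sup>2" if "j < n" for j
    using that by (simp add: c_nth power2_eq_square field_simps)
  hence "c \<bullet> c = (\<Sum>j<n. (if j = i then 1 - 2 / real n else 0) + 1 / (real n)\<^sup>2)"
    unfolding scalar_prod_self[OF c] by (intro sum.cong) auto
  also have "\<dots> = 1 - 2 / real n + real n * (1 / (real n)\<^sup>2)"
    using assms(1) by (simp add: sum.distrib)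
  finally show "c \<bullet> c = (real n - 1) / real n"
    using assms(1) by (simp add: power2_eq_square field_simps)
  show "unit_vec n i = c + (1 / real n) \<cdot>\<^sub>v one_vec n"
    using assms(1) by (intro eq_vecI) (simp_all add: c_def one_vec_def)
qed

text \<open>The common shape of \<open>C22\<close> and of the direct-effects information matrix:
  such a form is determined by its values on contrasts.\<close>

locale contrast_matrix =
  fixes n :: nat and C :: "real mat"
  assumes C: "C \<in> carrier_mat n n" and sym: "transpose_mat C = C"
    and C_one: "C *\<^sub>v one_vec n = 0\<^sub>v n" and n_pos: "n > 0"
begin

lemma mult_vec_closed [simp]: "x \<in> carrier_vec n \<Longrightarrow> C *\<^sub>v x \<in> carrier_vec n"
  using C by simp

lemma scalar_prod_mult: "x \<in> carrier_vec n \<Longrightarrow> y \<in> carrier_vec n \<Longrightarrow> x \<bullet> (C *\<^sub>v y) = (C *\<^sub>v x) \<bullet> y"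
  by (rule symmetric_mat_scalar_prod[OF C sym])

lemma mult_contrast: "x \<in> carrier_vec n \<Longrightarrow> (C *\<^sub>v x) \<bullet> one_vec n = 0"
  using scalar_prod_mult[of x "one_vec n"] C_one by simp

lemma kernel_eq_one_vec:
  assumes pos: "\<mu> > 0" "\<And>x. x \<in> carrier_vec n \<Longrightarrow> x \<bullet> one_vec n = 0 \<Longrightarrow> \<mu> * (x \<bullet> x) \<le> x \<bullet> (C *\<^sub>v x)"
    and v: "v \<in> carrier_vec n" "C *\<^sub>v v = 0\<^sub>v n"
  obtains a where "v = a \<cdot>\<^sub>v one_vec n"
proof -
  obtain c a where c: "c \<in> carrier_vec n" "c \<bullet> one_vec n = 0" "v = c + a \<cdot>\<^sub>v one_vec n"
    using contrast_decomposition[OF n_pos v(1)] by blast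
  have "C *\<^sub>v c = 0\<^sub>v n"
    using v(2) mult_add_one_vec[OF C C_one c(1), of a] c(3) by simp
  hence "\<mu> * (c \<bullet> c) \<le> 0" using pos(2)[OF c(1,2)] c(1) by simp
  hence "c \<bullet> c = 0"
    using pos(1) scalar_prod_self_nonneg[OF c(1)] by (simp add: mult_le_0_iff)
  hence "c = 0\<^sub>v n" by (rule scalar_prod_self_eq_0[OF c(1)])
  thus ?thesis using that[of a] c(3) by simp
qed

lemma moore_penrose_facts:
  defines "X \<equiv> moore_penrose C"
  shows "X \<in> carrier_mat n n"
    and "x \<in> carrier_vec n \<Longrightarrow> y \<in> carrier_vec n \<Longrightarrow> x \<bullet> (X *\<^sub>v y) = (X *\<^sub>v x) \<bullet> y"
    and "x \<in> carrier_vec n \<Longrightarrow> X *\<^sub>v (C *\<^sub>v x) = C *\<^sub>v (X *\<^sub>v x)"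
    and "x \<in> carrier_vec n \<Longrightarrow> X *\<^sub>v (C *\<^sub>v (X *\<^sub>v x)) = X *\<^sub>v x"
    and "x \<in> carrier_vec n \<Longrightarrow> C *\<^sub>v (X *\<^sub>v (C *\<^sub>v x)) = C *\<^sub>v x"
    and "X *\<^sub>v one_vec n = 0\<^sub>v n"
proof -
  note X = moore_penrose_symmetric[OF C sym, folded X_def]
  show X_car: "X \<in> carrier_mat n n" by (rule X)
  have XC: "X * C \<in> carrier_mat n n" "C * X \<in> carrier_mat n n" using C X_car by auto
  show "x \<bullet> (X *\<^sub>v y) = (X *\<^sub>v x) \<bullet> y" if "x \<in> carrier_vec n" "y \<in> carrier_vec n"
    using symmetric_mat_scalar_prod[OF X(1,2) that] .
  show comm: "X *\<^sub>v (C *\<^sub>v x) = C *\<^sub>v (X *\<^sub>v x)" if "x \<in> carrier_vec n" for x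
    using arg_cong[OF X(3), of "\<lambda>M. M *\<^sub>v x"] that C X_car
    by (simp add: assoc_mult_mat_vec[of _ n n _ n])
  show XCX: "X *\<^sub>v (C *\<^sub>v (X *\<^sub>v x)) = X *\<^sub>v x" if "x \<in> carrier_vec n" for x
    using arg_cong[OF X(4), of "\<lambda>M. M *\<^sub>v x"] that C X_car XC
    by (simp add: assoc_mult_mat_vec[of _ n n _ n])
  have "C * (X * C) = C"
    using X(5) .
  from arg_cong[OF this, of "\<lambda>M. M *\<^sub>v x"]
  show "C *\<^sub>v (X *\<^sub>v (C *\<^sub>v x)) = C *\<^sub>v x" if "x \<in> carrier_vec n"
    using that C X_car XC by (simp add: assoc_mult_mat_vec[of _ n n _ n])
  show "X *\<^sub>v one_vec n = 0\<^sub>v n"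
  proof -
    have "X *\<^sub>v 0\<^sub>v n = 0\<^sub>v n" using X_car by (intro eq_vecI) auto
    thus ?thesis using XCX[of "one_vec n"] comm[of "one_vec n", symmetric] C_one by simp
  qed
qed

lemma trace_moore_penrose:
  "trace (moore_penrose C)
    = (\<Sum>i<n. unit_vec n i \<bullet> (moore_penrose C *\<^sub>v unit_vec n i))"
  using moore_penrose_facts(1) by (simp add: trace_def)

lemma trace_moore_penrose_bounds:
  assumes "\<And>c. c \<in> carrier_vec n \<Longrightarrow> c \<bullet> one_vec n = 0 \<Longrightarrow>
    l * (c \<bullet> c) \<le> c \<bullet> (moore_penrose C *\<^sub>v c) \<and> c \<bullet> (moore_penrose C *\<^sub>v c) \<le> u * (c \<bullet> c)"
  shows "l * (real n - 1) \<le> trace (moore_penrose C)" "trace (moore_penrose C) \<le> u * (real n - 1)"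
proof -
  let ?X = "moore_penrose C"
  have *: "l * ((real n - 1) / n) \<le> unit_vec n i \<bullet> (?X *\<^sub>v unit_vec n i)
      \<and> unit_vec n i \<bullet> (?X *\<^sub>v unit_vec n i) \<le> u * ((real n - 1) / n)" if "i < n" for i
  proof -
    define c where "c = unit_vec n i - (1 / real n) \<cdot>\<^sub>v one_vec n"
    note c = unit_vec_decomposition[OF that, folded c_def]
    have Xe: "?X *\<^sub>v unit_vec n i = ?X *\<^sub>v c"
      unfolding c(4) by (rule mult_add_one_vec[OF moore_penrose_facts(1,6) c(1)])
    have "unit_vec n i \<bullet> (?X *\<^sub>v c) = (?X *\<^sub>v unit_vec n i) \<bullet> c"
      by (rule moore_penrose_facts(2)) (use c in auto)
    also have "\<dots> = c \<bullet> (?X *\<^sub>v c)"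
      unfolding Xe using moore_penrose_facts(2)[OF c(1,1)] by simp
    finally show ?thesis using assms[OF c(1,2)] by (simp add: Xe c(3))
  qed
  have "(\<Sum>i<n. l * ((real n - 1) / n)) \<le> trace ?X"
    unfolding trace_moore_penrose by (intro sum_mono) (use * in auto)
  thus "l * (real n - 1) \<le> trace (moore_penrose C)" using n_pos by simp
  have "trace ?X \<le> (\<Sum>i<n. u * ((real n - 1) / n))"
    unfolding trace_moore_penrose by (intro sum_mono) (use * in auto)
  thus "trace (moore_penrose C) \<le> u * (real n - 1)" using n_pos by simp
qed

text \<open>With X the Moore-Penrose inverse and r = X x, the identity x'Xx = x'XCXx = r'Cr moves
  the question to C, and r is a contrast because X annihilates \<open>one_vec n\<close>.\<close>

lemma trace_moore_penrose_nonneg: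
  assumes "\<And>x. x \<in> carrier_vec n \<Longrightarrow> x \<bullet> one_vec n = 0 \<Longrightarrow> 0 \<le> x \<bullet> (C *\<^sub>v x)"
  shows "0 \<le> trace (moore_penrose C)"
proof -
  let ?X = "moore_penrose C"
  note X = moore_penrose_facts
  have "0 \<le> x \<bullet> (?X *\<^sub>v x)" if x: "x \<in> carrier_vec n" for x
  proof -
    let ?r = "?X *\<^sub>v x"
    have r: "?r \<in> carrier_vec n" using X(1) x by simp
    have "?r \<bullet> one_vec n = 0"
      using X(2)[OF x one_vec_carrier] X(6) x by simp
    hence "0 \<le> ?r \<bullet> (C *\<^sub>v ?r)" by (rule assms[OF r])
    also have "\<dots> = x \<bullet> (?X *\<^sub>v (C *\<^sub>v ?r))" using X(2)[OF x, of "C *\<^sub>v ?r"] r by simp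
    also have "\<dots> = x \<bullet> ?r" by (simp add: X(4)[OF x])
    finally show ?thesis .
  qed
  thus ?thesis unfolding trace_moore_penrose by (intro sum_nonneg) simp
qed

text \<open>Put r = X c with X the Moore-Penrose inverse. The upper bound on c'r follows from |c - l
  r|^2 >= 0 and l |r|^2 <= r'Cr = c'r. The lower bound follows from nonnegativity of the form of C
  at r - c/u, expanded with C r = c.\<close>

lemma trace_moore_penrose_eigenvalue_bounds:
  assumes l: "l > 0" "\<And>x. x \<in> carrier_vec n \<Longrightarrow> x \<bullet> one_vec n = 0 \<Longrightarrow> l * (x \<bullet> x) \<le> x \<bullet> (C *\<^sub>v x)"
    and u: "u > 0" "\<And>x. x \<in> carrier_vec n \<Longrightarrow> x \<bullet> one_vec n = 0 \<Longrightarrow> x \<bullet> (C *\<^sub>v x) \<le> u * (x \<bullet> x)"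
  shows "(real n - 1) / u \<le> trace (moore_penrose C)" "trace (moore_penrose C) \<le> (real n - 1) / l"
proof -
  let ?X = "moore_penrose C"
  note X = moore_penrose_facts
  have "c \<bullet> c / u \<le> c \<bullet> (?X *\<^sub>v c) \<and> c \<bullet> (?X *\<^sub>v c) \<le> c \<bullet> c / l"
    if c: "c \<in> carrier_vec n" "c \<bullet> one_vec n = 0" for c
  proof
    define r where "r = ?X *\<^sub>v c"
    have r: "r \<in> carrier_vec n" using X(1) c by (simp add: r_def)
    have r_one: "r \<bullet> one_vec n = 0"
      using X(2)[OF c(1) one_vec_carrier] X(6) c by (simp add: r_def)
    have rCr: "r \<bullet> (C *\<^sub>v r) = c \<bullet> r"
      using X(2)[OF c(1), of "C *\<^sub>v r"] r X(4)[OF c(1)] by (simp add: r_def)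
    have r_comm: "r \<bullet> c = c \<bullet> r" using c r by (simp add: comm_scalar_prod[of _ n])
    have "0 \<le> (c - l \<cdot>\<^sub>v r) \<bullet> (c - l \<cdot>\<^sub>v r)"
      by (rule scalar_prod_self_nonneg[of _ n]) (use c r in auto)
    also have "\<dots> = c \<bullet> c - 2 * l * (c \<bullet> r) + l * (l * (r \<bullet> r))"
      using c r r_comm by (simp add: minus_scalar_prod_distrib[of _ n] scalar_prod_minus_distrib[of _ n] algebra_simps)
    also have "l * (l * (r \<bullet> r)) \<le> l * (c \<bullet> r)"
      using l(2)[OF r r_one] l(1) rCr by (intro mult_left_mono) auto
    finally have "l * (c \<bullet> r) \<le> c \<bullet> c" by (simp add: algebra_simps)
    thus "c \<bullet> (?X *\<^sub>v c) \<le> c \<bullet> c / l" using l(1) by (simp add: r_def field_simps)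
    \<comment> \<open>By the lower bound, C is injective on contrasts, and c - C r is a contrast in
      its kernel. So X inverts C on contrasts.\<close>
    have Cr: "C *\<^sub>v r = c"
    proof -
      let ?w = "c - C *\<^sub>v r"
      have w: "?w \<in> carrier_vec n" using c r by auto
      have "C *\<^sub>v ?w = C *\<^sub>v c - C *\<^sub>v (C *\<^sub>v r)"
        using C c r by (simp add: mult_minus_distrib_mat_vec[of _ n n])
      also have "C *\<^sub>v (C *\<^sub>v r) = C *\<^sub>v c"
        using X(3)[OF c(1)] X(5)[OF c(1)] by (simp add: r_def)
      finally have "C *\<^sub>v ?w = 0\<^sub>v n" using c by simp
      moreover have "?w \<bullet> one_vec n = 0"
        using c r mult_contrast[OF r] by (simp add: minus_scalar_prod_distrib[of _ n])
      ultimately have "l * (?w \<bullet> ?w) \<le> 0" using l(2)[OF w] w by simp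
      hence "?w \<bullet> ?w = 0"
        using l(1) scalar_prod_self_nonneg[OF w] by (simp add: mult_le_0_iff)
      hence "?w = 0\<^sub>v n" by (rule scalar_prod_self_eq_0[OF w])
      hence "(c - C *\<^sub>v r) $ i = 0" if "i < n" for i using that by simp
      thus ?thesis using c r C by (intro eq_vecI) auto
    qed
    let ?k = "1 / u"
    have "0 \<le> l * ((r - ?k \<cdot>\<^sub>v c) \<bullet> (r - ?k \<cdot>\<^sub>v c))"
      using l(1) scalar_prod_self_nonneg[of "r - ?k \<cdot>\<^sub>v c" n] c r by simp
    also have "\<dots> \<le> (r - ?k \<cdot>\<^sub>v c) \<bullet> (C *\<^sub>v (r - ?k \<cdot>\<^sub>v c))"
      using c r r_one by (intro l(2)) (auto simp: minus_scalar_prod_distrib[of _ n])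
    also have "C *\<^sub>v (r - ?k \<cdot>\<^sub>v c) = c - ?k \<cdot>\<^sub>v (C *\<^sub>v c)"
      using C c r Cr by (simp add: mult_minus_distrib_mat_vec[of _ n n] mult_mat_vec[of _ n n])
    also have "(r - ?k \<cdot>\<^sub>v c) \<bullet> (c - ?k \<cdot>\<^sub>v (C *\<^sub>v c))
        = c \<bullet> r - ?k * (r \<bullet> (C *\<^sub>v c)) - ?k * (c \<bullet> c) + ?k * (?k * (c \<bullet> (C *\<^sub>v c)))"
      using c r r_comm by (simp add: minus_scalar_prod_distrib[of _ n] scalar_prod_minus_distrib[of _ n] algebra_simps)
    also have "r \<bullet> (C *\<^sub>v c) = c \<bullet> c"
      using scalar_prod_mult[OF r c(1)] Cr by simp
    also have "?k * (?k * (c \<bullet> (C *\<^sub>v c))) \<le> ?k * (?k * (u * (c \<bullet> c)))"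
      using u(2)[OF c] u(1) by (intro mult_left_mono) auto
    finally show "c \<bullet> c / u \<le> c \<bullet> (?X *\<^sub>v c)"
      using u(1) by (simp add: r_def)
  qed
  from trace_moore_penrose_bounds[of "1 / u" "1 / l"] this
  show "(real n - 1) / u \<le> trace ?X" "trace ?X \<le> (real n - 1) / l" by simp_all
qed

end

subsection \<open>Schur complements\<close>

lemma generalized_inverse_sandwich:
  fixes C :: "real mat"
  assumes C: "C \<in> carrier_mat n n" "transpose_mat C = C" and G: "generalized_inverse C G"
    and x: "x \<in> carrier_vec n"
  shows "C *\<^sub>v (transpose_mat G *\<^sub>v (C *\<^sub>v x)) = C *\<^sub>v x"
proof -
  have G': "G \<in> carrier_mat n n" "C * G * C = C"
    using G C by (auto simp: generalized_inverse_def)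
  have CG: "C * G \<in> carrier_mat n n" using C G' by simp
  have "C = transpose_mat (C * G * C)" using G' C by simp
  also have "\<dots> = C * (transpose_mat G * C)"
    by (simp only: transpose_mult[OF CG C(1)] transpose_mult[OF C(1) G'(1)] C(2))
  finally have "C *\<^sub>v x = (C * (transpose_mat G * C)) *\<^sub>v x" by simp
  also have "\<dots> = C *\<^sub>v ((transpose_mat G * C) *\<^sub>v x)"
    by (rule assoc_mult_mat_vec[of _ n n _ n]) (use C G' x in \<open>auto intro: mult_carrier_mat[of _ n n]\<close>)
  also have "(transpose_mat G * C) *\<^sub>v x = transpose_mat G *\<^sub>v (C *\<^sub>v x)"
    by (rule assoc_mult_mat_vec[of _ n n _ n]) (use C G' x in auto)
  finally show ?thesis ..
qed

context contrast_matrix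
begin

text \<open>Contrasts lie in the range of C, and C G fixes that range. The proof reads off
  coordinates: for a unit vector e, the vector G'Ce - e lies in the kernel of C, hence is constant
  and orthogonal to z.\<close>

lemma generalized_inverse_range:
  assumes pos: "\<mu> > 0" "\<And>x. x \<in> carrier_vec n \<Longrightarrow> x \<bullet> one_vec n = 0 \<Longrightarrow> \<mu> * (x \<bullet> x) \<le> x \<bullet> (C *\<^sub>v x)"
    and G: "generalized_inverse C G"
    and z: "z \<in> carrier_vec n" "z \<bullet> one_vec n = 0"
  shows "C *\<^sub>v (G *\<^sub>v z) = z"
proof (rule eq_vecI)
  have Gc: "G \<in> carrier_mat n n" using G C by (auto simp: generalized_inverse_def)
  show "dim_vec (C *\<^sub>v (G *\<^sub>v z)) = dim_vec z" using C z by simp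
  fix i assume "i < dim_vec z"
  hence i: "i < n" using z by simp
  define e where "e = (unit_vec n i :: real vec)"
  have e: "e \<in> carrier_vec n" by (simp add: e_def)
  define h where "h = transpose_mat G *\<^sub>v (C *\<^sub>v e)"
  have h: "h \<in> carrier_vec n" using Gc e by (simp add: h_def)
  define v where "v = h - e"
  have v: "v \<in> carrier_vec n" using h e by (simp add: v_def)
  have "C *\<^sub>v v = 0\<^sub>v n"
    using generalized_inverse_sandwich[OF C sym G e] C h e
    by (simp add: v_def h_def[symmetric] mult_minus_distrib_mat_vec[of _ n n])
  then obtain a where a: "v = a \<cdot>\<^sub>v one_vec n"
    using kernel_eq_one_vec[OF pos v] by blast
  have Gz: "G *\<^sub>v z \<in> carrier_vec n" using Gc z by simp
  have "(C *\<^sub>v (G *\<^sub>v z)) $ i = e \<bullet> (C *\<^sub>v (G *\<^sub>v z))"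
    using C i by (simp add: e_def scalar_prod_left_unit[OF mult_vec_closed[OF Gz]])
  also have "\<dots> = (C *\<^sub>v e) \<bullet> (G *\<^sub>v z)" by (rule scalar_prod_mult[OF e Gz])
  also have "\<dots> = h \<bullet> z"
    unfolding h_def using transpose_vec_mult_scalar[OF Gc z(1) mult_vec_closed[OF e]] by simp
  also have "h = v + e" using h e by (intro eq_vecI) (auto simp: v_def)
  also have "(v + e) \<bullet> z = e \<bullet> z"
    using z e v comm_scalar_prod[OF z(1) one_vec_carrier]
    by (simp add: a add_scalar_prod_distrib[of _ n])
  also have "\<dots> = z $ i" using i z by (simp add: e_def scalar_prod_left_unit[OF z(1)])
  finally show "(C *\<^sub>v (G *\<^sub>v z)) $ i = z $ i" .
qed

end

lemma symmetric_matI: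
  fixes M :: "real mat"
  assumes M: "M \<in> carrier_mat n n"
    and eq: "\<And>x y. x \<in> carrier_vec n \<Longrightarrow> y \<in> carrier_vec n \<Longrightarrow> x \<bullet> (M *\<^sub>v y) = y \<bullet> (M *\<^sub>v x)"
  shows "transpose_mat M = M"
proof (rule eq_matI)
  fix i j assume "i < dim_row M" "j < dim_col M"
  hence ij: "i < n" "j < n" using M by auto
  have "unit_vec n k \<bullet> (M *\<^sub>v unit_vec n l) = M $$ (k, l)" if "k < n" "l < n" for k l
    using that M scalar_prod_left_unit[of "M *\<^sub>v unit_vec n l" n k] by simp
  thus "transpose_mat M $$ (i, j) = M $$ (i, j)"
    using eq[of "unit_vec n i" "unit_vec n j"] ij M by simp
qed (use M in auto)

text \<open>With \<open>K = G B'\<close>, completing the square gives \<open>Q(x, y) = x' M x + (y + K x)' C (y + K x)\<close>.\<close>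

lemma (in contrast_matrix) schur_complement:
  fixes A B G :: "real mat"
  assumes pos: "\<mu> > 0" "\<And>x. x \<in> carrier_vec n \<Longrightarrow> x \<bullet> one_vec n = 0 \<Longrightarrow> \<mu> * (x \<bullet> x) \<le> x \<bullet> (C *\<^sub>v x)"
    and G: "generalized_inverse C G"
    and A: "A \<in> carrier_mat n n" "transpose_mat A = A" "A *\<^sub>v one_vec n = 0\<^sub>v n"
    and B: "B \<in> carrier_mat n n" "B *\<^sub>v one_vec n = 0\<^sub>v n" "transpose_mat B *\<^sub>v one_vec n = 0\<^sub>v n"
  defines "M \<equiv> A - B * G * transpose_mat B"
    and "Q \<equiv> \<lambda>x y. x \<bullet> (A *\<^sub>v x) + 2 * (x \<bullet> (B *\<^sub>v y)) + y \<bullet> (C *\<^sub>v y)"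
  shows "contrast_matrix n M"
    and "x \<in> carrier_vec n \<Longrightarrow> \<exists>y \<in> carrier_vec n. y \<bullet> one_vec n = 0 \<and> x \<bullet> (M *\<^sub>v x) = Q x y"
    and "x \<in> carrier_vec n \<Longrightarrow> y \<in> carrier_vec n \<Longrightarrow> x \<bullet> (M *\<^sub>v x) \<le> Q x y"
proof -
  have Gc: "G \<in> carrier_mat n n" using G C by (auto simp: generalized_inverse_def)
  define K where "K x = G *\<^sub>v (transpose_mat B *\<^sub>v x)" for x
  have BT: "transpose_mat B \<in> carrier_mat n n" using B by simp
  have K [simp]: "K x \<in> carrier_vec n" if "x \<in> carrier_vec n" for x
    using that Gc BT by (simp add: K_def)
  have BTx: "transpose_mat B *\<^sub>v x \<in> carrier_vec n" if "x \<in> carrier_vec n" for x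
    using that BT by simp
  have Bt: "x \<bullet> (B *\<^sub>v y) = (transpose_mat B *\<^sub>v x) \<bullet> y"
    if "x \<in> carrier_vec n" "y \<in> carrier_vec n" for x y
    using transpose_vec_mult_scalar[OF B(1) that(2,1)] by simp
  \<comment> \<open>Since B annihilates the constants, B'x is a contrast. Thus K x solves the normal
    equations for the carry-over effects, up to sign, for every choice of G.\<close>
  have CK: "C *\<^sub>v K x = transpose_mat B *\<^sub>v x" if "x \<in> carrier_vec n" for x
    unfolding K_def
  proof (rule generalized_inverse_range[OF pos G BTx[OF that]])
    show "(transpose_mat B *\<^sub>v x) \<bullet> one_vec n = 0"
      using Bt[OF that one_vec_carrier] B(2) that by simp
  qed
  have M: "M \<in> carrier_mat n n"
    using A B Gc by (auto simp: M_def intro!: mult_carrier_mat[of _ n n])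
  have Mx: "M *\<^sub>v x = A *\<^sub>v x - B *\<^sub>v K x" if "x \<in> carrier_vec n" for x
  proof -
    have BG: "B * G \<in> carrier_mat n n" using B Gc by simp
    have "(B * G * transpose_mat B) *\<^sub>v x = B *\<^sub>v K x"
      unfolding K_def
      by (simp only: assoc_mult_mat_vec[OF BG BT that] assoc_mult_mat_vec[OF B(1) Gc BTx[OF that]])
    moreover have "B * G * transpose_mat B \<in> carrier_mat n n" by (rule mult_carrier_mat[OF BG BT])
    ultimately show ?thesis
      using minus_mult_distrib_mat_vec[OF A(1) _ that] by (simp add: M_def)
  qed
  \<comment> \<open>Through K the form of M is visibly symmetric, although G need not be.\<close>
  have form: "x \<bullet> (M *\<^sub>v y) = x \<bullet> (A *\<^sub>v y) - K x \<bullet> (C *\<^sub>v K y)"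
    if xy: "x \<in> carrier_vec n" "y \<in> carrier_vec n" for x y
  proof -
    have "x \<bullet> (B *\<^sub>v K y) = (C *\<^sub>v K x) \<bullet> K y" using Bt[OF xy(1)] xy CK by simp
    also have "\<dots> = K x \<bullet> (C *\<^sub>v K y)" using scalar_prod_mult[of "K x" "K y"] xy by simp
    finally show ?thesis
      using xy A B by (simp add: Mx scalar_prod_minus_distrib[of _ n])
  qed
  have square: "Q x y = x \<bullet> (M *\<^sub>v x) + (y + K x) \<bullet> (C *\<^sub>v (y + K x))"
    if xy: "x \<in> carrier_vec n" "y \<in> carrier_vec n" for x y
  proof -
    have "K x \<bullet> (C *\<^sub>v y) = x \<bullet> (B *\<^sub>v y)"
      using scalar_prod_mult[of "K x" y] xy CK Bt by simp
    moreover have "y \<bullet> (C *\<^sub>v K x) = x \<bullet> (B *\<^sub>v y)"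
      using xy CK Bt BTx comm_scalar_prod[of y n "transpose_mat B *\<^sub>v x"] by simp
    ultimately have "(y + K x) \<bullet> (C *\<^sub>v (y + K x))
        = y \<bullet> (C *\<^sub>v y) + 2 * (x \<bullet> (B *\<^sub>v y)) + K x \<bullet> (C *\<^sub>v K x)"
      using xy C by (simp add: mult_add_distrib_mat_vec[of _ n n] add_scalar_prod_distrib[of _ n]
          scalar_prod_add_distrib[of _ n])
    thus ?thesis using form[OF xy(1,1)] by (simp add: Q_def)
  qed
  have psd: "0 \<le> v \<bullet> (C *\<^sub>v v)" if v: "v \<in> carrier_vec n" for v
  proof -
    obtain c a where c: "c \<in> carrier_vec n" "c \<bullet> one_vec n = 0" "v = c + a \<cdot>\<^sub>v one_vec n"
      using contrast_decomposition[OF n_pos v] by blast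
    have "C *\<^sub>v v = C *\<^sub>v c" unfolding c(3) by (rule mult_add_one_vec[OF C C_one c(1)])
    hence "v \<bullet> (C *\<^sub>v v) = (C *\<^sub>v c) \<bullet> c"
      using scalar_prod_mult[OF v c(1)] by simp
    also have "\<dots> = c \<bullet> (C *\<^sub>v c)" using scalar_prod_mult[OF c(1,1)] by simp
    also have "\<dots> \<ge> 0"
      using pos(2)[OF c(1,2)] mult_nonneg_nonneg[of \<mu> "c \<bullet> c"] pos(1) scalar_prod_self_nonneg[OF c(1)]
      by linarith
    finally show ?thesis .
  qed
  show "x \<bullet> (M *\<^sub>v x) \<le> Q x y" if "x \<in> carrier_vec n" "y \<in> carrier_vec n"
    using square[OF that] psd[of "y + K x"] that by simp
  show "\<exists>y \<in> carrier_vec n. y \<bullet> one_vec n = 0 \<and> x \<bullet> (M *\<^sub>v x) = Q x y"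
    if x: "x \<in> carrier_vec n"
  proof -
    \<comment> \<open>The minimizer -K x need not be a contrast. Its contrast part -c differs from
      it by a constant vector, which lies in the kernel of C, so the minimum is attained there
      too.\<close>
    obtain c a where c: "c \<in> carrier_vec n" "c \<bullet> one_vec n = 0" "K x = c + a \<cdot>\<^sub>v one_vec n"
      using contrast_decomposition[OF n_pos K[OF x]] by blast
    have "- c + K x = 0\<^sub>v n + a \<cdot>\<^sub>v one_vec n"
      unfolding c(3) using c(1) by (intro eq_vecI) (auto simp: one_vec_def)
    hence "C *\<^sub>v (- c + K x) = C *\<^sub>v 0\<^sub>v n"
      using mult_add_one_vec[OF C C_one, of "0\<^sub>v n" a] by simp
    also have "\<dots> = 0\<^sub>v n" using C by (intro eq_vecI) auto
    finally have "Q x (- c) = x \<bullet> (M *\<^sub>v x)"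
      using square[OF x, of "- c"] c(1) x by simp
    moreover have "- c \<bullet> one_vec n = 0"
      using c by (subst scalar_prod_uminus_left) (simp_all add: one_vec_def)
    ultimately show ?thesis using c(1) by (intro bexI[of _ "- c"]) auto
  qed
  show "contrast_matrix n M"
  proof
    show "transpose_mat M = M"
    proof (rule symmetric_matI[OF M])
      fix x y :: "real vec" assume xy: "x \<in> carrier_vec n" "y \<in> carrier_vec n"
      have Ax: "A *\<^sub>v x \<in> carrier_vec n" using A(1) xy by simp
      have "x \<bullet> (A *\<^sub>v y) = y \<bullet> (A *\<^sub>v x)"
        using symmetric_mat_scalar_prod[OF A(1,2) xy] comm_scalar_prod[OF Ax xy(2)] by simp
      moreover have "K x \<bullet> (C *\<^sub>v K y) = K y \<bullet> (C *\<^sub>v K x)"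
        using scalar_prod_mult[of "K x" "K y"] xy comm_scalar_prod[of "C *\<^sub>v K x" n "K y"] by simp
      ultimately show "x \<bullet> (M *\<^sub>v y) = y \<bullet> (M *\<^sub>v x)" using form xy by simp
    qed
    show "M *\<^sub>v one_vec n = 0\<^sub>v n"
    proof -
      have "G *\<^sub>v 0\<^sub>v n = 0\<^sub>v n" "B *\<^sub>v 0\<^sub>v n = 0\<^sub>v n"
        using Gc B(1) by (intro eq_vecI; auto)+
      thus ?thesis using Mx[OF one_vec_carrier] A(3) B(3) by (simp add: K_def)
    qed
  qed (use M n_pos in auto)
qed

subsection \<open>Entries of the information matrices\<close>

lemma sum_lessThan_mult:
  fixes f :: "nat \<Rightarrow> real"
  shows "(\<Sum>r<s * p. f r) = (\<Sum>i<s. \<Sum>k<p. f (i * p + k))"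
proof -
  have "(\<Sum>r\<in>{i * p..<i * p + p}. f r) = (\<Sum>k<p. f (i * p + k))" for i
    using sum.shift_bounds_nat_ivl[of f 0 "i * p" p] by (simp add: lessThan_atLeast0 add.commute)
  thus ?thesis by (simp flip: sum.nat_group)
qed

lemma row_index_less: "i < s \<Longrightarrow> k < p \<Longrightarrow> i * p + k < s * p" for i k s p :: nat
  by (metis add.commute add_less_cancel_left less_le_trans mult_Suc mult_le_mono1 Suc_leI)

lemma X_S_carrier [simp]: "X_S p s \<in> carrier_mat (s * p) s"
  by (simp add: X_S_def kronecker_def ones_def)

lemma X_P_carrier [simp]: "X_P p s \<in> carrier_mat (s * p) p"
  by (simp add: X_P_def kronecker_def ones_def)

lemma X_S_nth: "i < s \<Longrightarrow> k < p \<Longrightarrow> j < s \<Longrightarrow> X_S p s $$ (i * p + k, j) = (if i = j then 1 else 0)"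
  using row_index_less[of i s k p] by (simp add: X_S_def kronecker_def ones_def)

lemma X_P_nth: "i < s \<Longrightarrow> k < p \<Longrightarrow> l < p \<Longrightarrow> X_P p s $$ (i * p + k, l) = (if k = l then 1 else 0)"
  using row_index_less[of i s k p] by (simp add: X_P_def kronecker_def ones_def)

lemma transpose_mult_nth:
  fixes A X :: "real mat"
  assumes "A \<in> carrier_mat (s * p) t" "X \<in> carrier_mat (s * p) n" "a < t" "j < n"
  shows "(transpose_mat A * X) $$ (a, j)
    = (\<Sum>i<s. \<Sum>k<p. A $$ (i * p + k, a) * X $$ (i * p + k, j))"
proof -
  have "(transpose_mat A * X) $$ (a, j) = (\<Sum>r<s * p. A $$ (r, a) * X $$ (r, j))"
    using assms by (simp add: scalar_prod_def lessThan_atLeast0)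
  thus ?thesis by (simp add: sum_lessThan_mult)
qed

lemma transpose_mult_X_S:
  assumes "A \<in> carrier_mat (s * p) t" "a < t" "j < s"
  shows "(transpose_mat A * X_S p s) $$ (a, j) = (\<Sum>k<p. A $$ (j * p + k, a))"
proof -
  have "(transpose_mat A * X_S p s) $$ (a, j)
      = (\<Sum>i<s. \<Sum>k<p. A $$ (i * p + k, a) * X_S p s $$ (i * p + k, j))"
    by (rule transpose_mult_nth[OF assms(1) X_S_carrier assms(2,3)])
  also have "\<dots> = (\<Sum>i<s. if i = j then \<Sum>k<p. A $$ (j * p + k, a) else 0)"
    using assms(3) by (intro sum.cong refl) (simp add: X_S_nth)
  finally show ?thesis using assms(3) by simp
qed

lemma transpose_mult_X_P:
  assumes "A \<in> carrier_mat (s * p) t" "a < t" "l < p"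
  shows "(transpose_mat A * X_P p s) $$ (a, l) = (\<Sum>i<s. A $$ (i * p + l, a))"
proof -
  have "(transpose_mat A * X_P p s) $$ (a, l)
      = (\<Sum>i<s. \<Sum>k<p. A $$ (i * p + k, a) * X_P p s $$ (i * p + k, l))"
    by (rule transpose_mult_nth[OF assms(1) X_P_carrier assms(2,3)])
  also have "\<dots> = (\<Sum>i<s. \<Sum>k<p. if k = l then A $$ (i * p + k, a) else 0)"
    using assms(3) by (intro sum.cong refl) (simp add: X_P_nth)
  finally show ?thesis using assms(3) by simp
qed

lemma replications_nth:
  assumes "A \<in> carrier_mat (s * p) t" "a < t"
  shows "(transpose_mat A * X_S p s * ones s) $$ (a, 0) = (\<Sum>i<s. \<Sum>k<p. A $$ (i * p + k, a))"
proof -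
  have c: "transpose_mat A * X_S p s \<in> carrier_mat t s"
    using assms(1) by (intro mult_carrier_mat[of _ t "s * p"]) auto
  have "(U * ones s) $$ (a, 0) = (\<Sum>i<s. U $$ (a, i))" if "U \<in> carrier_mat t s" for U
    using that assms(2) by (simp add: ones_def scalar_prod_def lessThan_atLeast0)
  from this[OF c] have "(transpose_mat A * X_S p s * ones s) $$ (a, 0)
      = (\<Sum>i<s. (transpose_mat A * X_S p s) $$ (a, i))" .
  thus ?thesis using assms by (simp add: transpose_mult_X_S)
qed

text \<open>N is kept apart from the residual form because the diagonal blocks use replication
  counts in place of A'B; \<open>replication_diag_nth\<close> shows that the two agree.\<close>

lemma adjusted_nth:
  assumes N: "N \<in> carrier_mat t t" and A: "A \<in> carrier_mat (s * p) t" and B: "B \<in> carrier_mat (s * p) t"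
    and ab: "a < t" "b < t"
  shows "adjusted p s N A B $$ (a, b)
    = N $$ (a, b) - (\<Sum>i<s. \<Sum>k<p. A $$ (i * p + k, a) * B $$ (i * p + k, b))
      + residual_form p s (\<lambda>k i. A $$ (i * p + k, a)) (\<lambda>k i. B $$ (i * p + k, b))"
proof -
  define SA where "SA = transpose_mat A * X_S p s"
  define SB where "SB = transpose_mat B * X_S p s"
  define PA where "PA = transpose_mat A * X_P p s"
  define PB where "PB = transpose_mat B * X_P p s"
  define rA where "rA = SA * ones s"
  define rB where "rB = SB * ones s"
  have c: "SA \<in> carrier_mat t s" "SB \<in> carrier_mat t s" "PA \<in> carrier_mat t p" "PB \<in> carrier_mat t p"
    unfolding SA_def SB_def PA_def PB_def
    using A B by (auto intro!: mult_carrier_mat[of _ t "s * p"])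
  have r: "rA \<in> carrier_mat t 1" "rB \<in> carrier_mat t 1"
    unfolding rA_def rB_def using c by (auto intro!: mult_carrier_mat[of _ t s] simp: ones_def)
  have t: "transpose_mat (X_S p s) * B = transpose_mat SB" "transpose_mat (X_P p s) * B = transpose_mat PB"
    unfolding SB_def PB_def using B
    by (simp_all add: transpose_mult[of "transpose_mat B" t "s * p" "X_S p s" s]
        transpose_mult[of "transpose_mat B" t "s * p" "X_P p s" p])
  have "adjusted p s N A B = N + (1 / (real p * real s)) \<cdot>\<^sub>m (rA * transpose_mat rB)
      - (1 / real p) \<cdot>\<^sub>m (SA * transpose_mat SB) - (1 / real s) \<cdot>\<^sub>m (PA * transpose_mat PB)"
    unfolding adjusted_def Let_def t rA_def rB_def SA_def[symmetric] SB_def[symmetric] PA_def[symmetric] ..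
  moreover have "(U * transpose_mat V) $$ (a, b) = (\<Sum>j<n. U $$ (a, j) * V $$ (b, j))"
    if "U \<in> carrier_mat t n" "V \<in> carrier_mat t n" for U V :: "real mat" and n
    using that ab by (simp add: scalar_prod_def lessThan_atLeast0)
  ultimately have "adjusted p s N A B $$ (a, b) = N $$ (a, b)
      + 1 / (real p * real s) * (rA $$ (a, 0) * rB $$ (b, 0))
      - 1 / real p * (\<Sum>j<s. SA $$ (a, j) * SB $$ (b, j))
      - 1 / real s * (\<Sum>j<p. PA $$ (a, j) * PB $$ (b, j))"
    using N c r ab by simp
  moreover have "rA $$ (a, 0) = (\<Sum>i<s. \<Sum>k<p. A $$ (i * p + k, a))"
    "rB $$ (b, 0) = (\<Sum>i<s. \<Sum>k<p. B $$ (i * p + k, b))"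
    unfolding rA_def rB_def SA_def SB_def using A B ab by (simp_all only: replications_nth)
  moreover have "(\<Sum>j<s. SA $$ (a, j) * SB $$ (b, j))
      = (\<Sum>j<s. (\<Sum>k<p. A $$ (j * p + k, a)) * (\<Sum>k<p. B $$ (j * p + k, b)))"
    unfolding SA_def SB_def
    using transpose_mult_X_S[OF A ab(1)] transpose_mult_X_S[OF B ab(2)]
    by (intro sum.cong refl) (simp only: lessThan_iff)
  moreover have "(\<Sum>j<p. PA $$ (a, j) * PB $$ (b, j))
      = (\<Sum>j<p. (\<Sum>i<s. A $$ (i * p + j, a)) * (\<Sum>i<s. B $$ (i * p + j, b)))"
    unfolding PA_def PB_def
    using transpose_mult_X_P[OF A ab(1)] transpose_mult_X_P[OF B ab(2)]
    by (intro sum.cong refl) (simp only: lessThan_iff)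
  ultimately show ?thesis by (simp add: residual_form_def)
qed

lemma adjusted_carrier:
  assumes "N \<in> carrier_mat t t" "A \<in> carrier_mat (s * p) t" "B \<in> carrier_mat (s * p) t"
  shows "adjusted p s N A B \<in> carrier_mat t t"
  using assms by (auto simp: adjusted_def Let_def)

lemma residual_form_cong:
  assumes "\<And>k i. k < p \<Longrightarrow> i < s \<Longrightarrow> v k i = v' k i" "\<And>k i. k < p \<Longrightarrow> i < s \<Longrightarrow> w k i = w' k i"
  shows "residual_form p s v w = residual_form p s v' w'"
  unfolding residual_form_def using assms by simp

lemma residual_form_sum_left:
  assumes "finite I"
  shows "residual_form p s (\<lambda>k i. \<Sum>a\<in>I. x a * v a k i) w = (\<Sum>a\<in>I. x a * residual_form p s (v a) w)"
  using assms
proof (induction I)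
  case empty
  show ?case by (simp add: residual_form_def)
next
  case (insert b I)
  have "residual_form p s (\<lambda>k i. c * u k i + u' k i) w
      = c * residual_form p s u w + residual_form p s u' w" for c u u'
    unfolding residual_form_def
    by (simp add: sum.distrib distrib_right mult.assoc flip: sum_distrib_left)
      (simp add: algebra_simps add_divide_distrib diff_divide_distrib)
  thus ?case using insert by simp
qed

lemma residual_form_sum_right:
  assumes "finite I"
  shows "residual_form p s v (\<lambda>k i. \<Sum>a\<in>I. y a * w a k i) = (\<Sum>a\<in>I. y a * residual_form p s v (w a))"
  using residual_form_sum_left[OF assms, of p s y w v] by (simp add: residual_form_commute)

definition indic :: "nat \<Rightarrow> nat \<Rightarrow> real" where
  "indic a c = (if c = a then 1 else 0)"

lemma X_D_carrier [simp]: "X_D p s t d \<in> carrier_mat (s * p) t"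
  by (simp add: X_D_def)

lemma X_C_carrier [simp]: "X_C p s t d \<in> carrier_mat (s * p) t"
  by (simp add: X_C_def)

lemma X_D_nth: "i < s \<Longrightarrow> k < p \<Longrightarrow> a < t \<Longrightarrow> X_D p s t d $$ (i * p + k, a) = direct_part d (indic a) k i"
  using row_index_less[of i s k p] by (simp add: X_D_def direct_part_def indic_def)

lemma X_C_nth: "i < s \<Longrightarrow> k < p \<Longrightarrow> a < t \<Longrightarrow> X_C p s t d $$ (i * p + k, a) = carry_part d (indic a) k i"
  using row_index_less[of i s k p] by (simp add: X_C_def carry_part_def indic_def)

lemma adjusted_scalar_prod:
  assumes A: "A \<in> carrier_mat (s * p) t" and B: "B \<in> carrier_mat (s * p) t" and N: "N \<in> carrier_mat t t"
    and N_eq: "\<And>a b. a < t \<Longrightarrow> b < t \<Longrightarrow>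
      N $$ (a, b) = (\<Sum>i<s. \<Sum>k<p. A $$ (i * p + k, a) * B $$ (i * p + k, b))"
    and xy: "x \<in> carrier_vec t" "y \<in> carrier_vec t"
    and v: "\<And>k i. k < p \<Longrightarrow> i < s \<Longrightarrow> v k i = (\<Sum>a<t. x $ a * A $$ (i * p + k, a))"
    and w: "\<And>k i. k < p \<Longrightarrow> i < s \<Longrightarrow> w k i = (\<Sum>a<t. y $ a * B $$ (i * p + k, a))"
  shows "x \<bullet> (adjusted p s N A B *\<^sub>v y) = residual_form p s v w"
proof -
  let ?M = "adjusted p s N A B"
  have M: "?M \<in> carrier_mat t t" by (rule adjusted_carrier[OF N A B])
  have "x \<bullet> (?M *\<^sub>v y) = (\<Sum>a<t. x $ a * (\<Sum>b<t. y $ b * ?M $$ (a, b)))"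
    using M xy by (simp add: scalar_prod_def lessThan_atLeast0 mult.commute)
  also have "\<dots> = (\<Sum>a<t. x $ a * (\<Sum>b<t. y $ b *
      residual_form p s (\<lambda>k i. A $$ (i * p + k, a)) (\<lambda>k i. B $$ (i * p + k, b))))"
    by (intro sum.cong refl arg_cong2[of _ _ _ _ "(*)"]) (simp add: adjusted_nth[OF N A B] N_eq)
  also have "\<dots> = residual_form p s (\<lambda>k i. \<Sum>a<t. x $ a * A $$ (i * p + k, a))
      (\<lambda>k i. \<Sum>b<t. y $ b * B $$ (i * p + k, b))"
    by (simp add: residual_form_sum_left residual_form_sum_right)
  also have "\<dots> = residual_form p s v w"
    by (rule residual_form_cong) (simp_all add: v w)
  finally show ?thesis .
qed

text \<open>The assumption \<open>idem\<close> says that a row has at most one nonzero entry and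
  that this entry is 1. Distinct columns are then orthogonal, and the squared length of a column is
  its replication.\<close>

lemma replication_diag_nth:
  assumes A: "A \<in> carrier_mat (s * p) t" and ab: "a < t" "b < t"
    and idem: "\<And>i k a b. i < s \<Longrightarrow> k < p \<Longrightarrow> a < t \<Longrightarrow> b < t \<Longrightarrow>
      A $$ (i * p + k, a) * A $$ (i * p + k, b) = (if a = b then A $$ (i * p + k, a) else 0)"
  shows "replication_diag p s t A $$ (a, b) = (\<Sum>i<s. \<Sum>k<p. A $$ (i * p + k, a) * A $$ (i * p + k, b))"
proof -
  have "replication_diag p s t A $$ (a, b)
      = (if a = b then \<Sum>i<s. \<Sum>k<p. A $$ (i * p + k, a) else 0)"
    using ab by (simp add: replication_diag_def Let_def mat_diag_def replications_nth[OF A] del: index_mult_mat(1))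
  thus ?thesis using ab by (auto simp: idem)
qed

lemma replication_diag_carrier [simp]: "replication_diag p s t A \<in> carrier_mat t t"
  by (simp add: replication_diag_def Let_def mat_diag_def)

context
  fixes p s t :: nat and d :: design
  assumes d: "is_design p s t d"
begin

lemma direct_part_sum:
  assumes "k < p" "i < s"
  shows "direct_part d x k i = (\<Sum>a<t. x a * X_D p s t d $$ (i * p + k, a))"
proof -
  have "(\<Sum>a<t. x a * X_D p s t d $$ (i * p + k, a)) = (\<Sum>a<t. if a = d k i then x a else 0)"
    using assms by (intro sum.cong refl) (simp add: X_D_nth direct_part_def indic_def)
  thus ?thesis using d assms by (simp add: is_design_def direct_part_def)
qed

lemma carry_part_sum:
  assumes "k < p" "i < s"
  shows "carry_part d y k i = (\<Sum>a<t. y a * X_C p s t d $$ (i * p + k, a))"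
proof (cases "k = 0")
  case True
  thus ?thesis using assms X_C_nth[OF assms(2,1)] by (simp add: carry_part_def)
next
  case False
  have "(\<Sum>a<t. y a * X_C p s t d $$ (i * p + k, a)) = (\<Sum>a<t. if a = d (k - 1) i then y a else 0)"
    using assms False by (intro sum.cong refl) (simp add: X_C_nth carry_part_def indic_def)
  thus ?thesis using d assms False by (simp add: is_design_def carry_part_def)
qed

lemma C11_scalar_prod:
  assumes "x \<in> carrier_vec t" "y \<in> carrier_vec t"
  shows "x \<bullet> (C11 p s t d *\<^sub>v y) = residual_form p s (direct_part d (($) x)) (direct_part d (($) y))"
  unfolding C11_def
proof (rule adjusted_scalar_prod[where t = t])
  show "replication_diag p s t (X_D p s t d) $$ (a, b)
      = (\<Sum>i<s. \<Sum>k<p. X_D p s t d $$ (i * p + k, a) * X_D p s t d $$ (i * p + k, b))"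
    if "a < t" "b < t" for a b
    by (rule replication_diag_nth[OF X_D_carrier that]) (simp add: X_D_nth direct_part_def indic_def)
qed (use assms in \<open>simp_all add: direct_part_sum\<close>)

lemma C22_scalar_prod:
  assumes "x \<in> carrier_vec t" "y \<in> carrier_vec t"
  shows "x \<bullet> (C22 p s t d *\<^sub>v y) = residual_form p s (carry_part d (($) x)) (carry_part d (($) y))"
  unfolding C22_def
proof (rule adjusted_scalar_prod[where t = t])
  show "replication_diag p s t (X_C p s t d) $$ (a, b)
      = (\<Sum>i<s. \<Sum>k<p. X_C p s t d $$ (i * p + k, a) * X_C p s t d $$ (i * p + k, b))"
    if "a < t" "b < t" for a b
    by (rule replication_diag_nth[OF X_C_carrier that]) (simp add: X_C_nth carry_part_def indic_def)
qed (use assms in \<open>simp_all add: carry_part_sum\<close>)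

lemma C12_scalar_prod:
  assumes "x \<in> carrier_vec t" "y \<in> carrier_vec t"
  shows "x \<bullet> (C12 p s t d *\<^sub>v y) = residual_form p s (direct_part d (($) x)) (carry_part d (($) y))"
  unfolding C12_def
proof (rule adjusted_scalar_prod[where t = t])
  show "(transpose_mat (X_D p s t d) * X_C p s t d) $$ (a, b)
      = (\<Sum>i<s. \<Sum>k<p. X_D p s t d $$ (i * p + k, a) * X_C p s t d $$ (i * p + k, b))"
    if "a < t" "b < t" for a b
    by (rule transpose_mult_nth[OF X_D_carrier X_C_carrier that])
  show "transpose_mat (X_D p s t d) * X_C p s t d \<in> carrier_mat t t"
    by (rule mult_carrier_mat[of _ t "s * p"]) simp_all
qed (use assms in \<open>simp_all add: direct_part_sum carry_part_sum\<close>)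

lemma C_carrier: "C11 p s t d \<in> carrier_mat t t" "C12 p s t d \<in> carrier_mat t t" "C22 p s t d \<in> carrier_mat t t"
  unfolding C11_def C12_def C22_def
  by (intro adjusted_carrier mult_carrier_mat[of _ t "s * p"]; simp)+

lemma joint_form_eq:
  assumes "x \<in> carrier_vec t" "y \<in> carrier_vec t"
  shows "x \<bullet> (C11 p s t d *\<^sub>v x) + 2 * (x \<bullet> (C12 p s t d *\<^sub>v y)) + y \<bullet> (C22 p s t d *\<^sub>v y)
    = joint_form p s d (($) x) (($) y)"
  using assms by (simp add: C11_scalar_prod C12_scalar_prod C22_scalar_prod joint_form_def)

text \<open>A design produces only labels below t. Hence the unspecified entries of a vector beyond
  its dimension do not matter, and \<open>($) x\<close> can be exchanged for an ordinary
  function.\<close>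

lemma joint_form_cong:
  assumes "\<And>a. a < t \<Longrightarrow> x a = x' a" "\<And>a. a < t \<Longrightarrow> y a = y' a"
  shows "joint_form p s d x y = joint_form p s d x' y'"
proof -
  have "direct_part d x k i = direct_part d x' k i" "carry_part d y k i = carry_part d y' k i"
    if "k < p" "i < s" for k i
    using that d assms by (simp_all add: direct_part_def carry_part_def is_design_def)
  thus ?thesis unfolding joint_form_def
    by (intro arg_cong2[of _ _ _ _ "(+)"] arg_cong2[of _ _ _ _ "(*)"] residual_form_cong refl)
qed

end

lemma mult_mat_vec_eq_0I:
  fixes M :: "real mat"
  assumes M: "M \<in> carrier_mat n n" and v: "v \<in> carrier_vec n"
    and "\<And>x. x \<in> carrier_vec n \<Longrightarrow> x \<bullet> (M *\<^sub>v v) = 0"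
  shows "M *\<^sub>v v = 0\<^sub>v n"
  by (rule scalar_prod_self_eq_0) (use assms in auto)

text \<open>A constant direct effect gives a constant response. A constant carry-over effect gives 0
  in the first period and 1 afterwards, which is again a pure period effect.\<close>

lemma residual_form_one_vec:
  assumes "is_design p s t d" "p > 0" "s > 0"
  shows "residual_form p s v (direct_part d (($) (one_vec t))) = 0"
    and "residual_form p s v (carry_part d (($) (one_vec t))) = 0"
proof -
  have "residual_form p s v (direct_part d (($) (one_vec t))) = residual_form p s v (\<lambda>k i. 1)"
    by (rule residual_form_cong) (use assms(1) in \<open>auto simp: direct_part_def one_vec_def is_design_def\<close>)
  thus "residual_form p s v (direct_part d (($) (one_vec t))) = 0"
    using residual_form_period_effect[OF assms(2,3), of v "\<lambda>_. 1"] by simp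
  have "residual_form p s v (carry_part d (($) (one_vec t))) = residual_form p s v (\<lambda>k i. if k = 0 then 0 else 1)"
    by (rule residual_form_cong) (use assms(1) in \<open>auto simp: carry_part_def one_vec_def is_design_def\<close>)
  thus "residual_form p s v (carry_part d (($) (one_vec t))) = 0"
    using residual_form_period_effect[OF assms(2,3), of v "\<lambda>k. if k = 0 then 0 else 1"] by simp
qed

section \<open>Information matrices and traces for the truncated and the full design\<close>

context ubrm_design
begin

lemma truncated_design: "is_design (t - m) (g * t) t d"
  using d_less by (simp add: is_design_def)

text \<open>Lower bounds on the information matrix use the minimizing contrast y of the second
  claim; upper bounds use the third claim with a trial y.\<close>

lemma information_matrix:
  assumes m: "m < t" and D: "theta_denom t m > 0"
    and M: "direct_information_matrix (t - m) (g * t) t d M"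
  shows "contrast_matrix t M"
    and "x \<in> carrier_vec t \<Longrightarrow> \<exists>y \<in> carrier_vec t. y \<bullet> one_vec t = 0 \<and>
      x \<bullet> (M *\<^sub>v x) = joint_form (t - m) (g * t) d (($) x) (($) y)"
    and "x \<in> carrier_vec t \<Longrightarrow> y \<in> carrier_vec t \<Longrightarrow>
      x \<bullet> (M *\<^sub>v x) \<le> joint_form (t - m) (g * t) d (($) x) (($) y)"
proof -
  let ?p = "t - m" and ?s = "g * t"
  let ?A = "C11 ?p ?s t d" and ?B = "C12 ?p ?s t d" and ?C = "C22 ?p ?s t d"
  note des = truncated_design[of m]
  note car = C_carrier[OF des]
  have pos: "?p > 0" "?s > 0" using m t_gt_1 g_pos by auto
  obtain G where G: "generalized_inverse ?C G" "M = ?A - ?B * G * transpose_mat ?B"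
    using M by (auto simp: direct_information_matrix_def C21_def)
  have A: "transpose_mat ?A = ?A" "?A *\<^sub>v one_vec t = 0\<^sub>v t"
    and C: "transpose_mat ?C = ?C" "?C *\<^sub>v one_vec t = 0\<^sub>v t"
    and B: "?B *\<^sub>v one_vec t = 0\<^sub>v t"
    using car
    by (auto intro!: symmetric_matI[of _ t] mult_mat_vec_eq_0I residual_form_commute
        simp: C11_scalar_prod[OF des] C12_scalar_prod[OF des] C22_scalar_prod[OF des]
          residual_form_one_vec[OF des pos])
  have B': "transpose_mat ?B *\<^sub>v one_vec t = 0\<^sub>v t"
  proof (rule mult_mat_vec_eq_0I)
    fix x :: "real vec" assume x: "x \<in> carrier_vec t"
    have "(transpose_mat ?B *\<^sub>v one_vec t) \<bullet> x = one_vec t \<bullet> (?B *\<^sub>v x)"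
      by (rule transpose_vec_mult_scalar[OF car(2) x one_vec_carrier])
    also have "\<dots> = 0"
      using x residual_form_one_vec(1)[OF des pos]
      by (simp add: C12_scalar_prod[OF des] residual_form_commute[of _ _ "direct_part d _"])
    finally show "x \<bullet> (transpose_mat ?B *\<^sub>v one_vec t) = 0"
      using x car(2) comm_scalar_prod[of x t "transpose_mat ?B *\<^sub>v one_vec t"] by simp
  qed (use car in auto)
  interpret C: contrast_matrix t ?C
    by unfold_locales (use car C t_gt_1 in auto)
  let ?\<mu> = "g * theta_denom t m / (real t - real m)"
  have \<mu>: "?\<mu> > 0" using g_pos D m by simp
  have C_ge: "?\<mu> * (y \<bullet> y) \<le> y \<bullet> (?C *\<^sub>v y)" if y: "y \<in> carrier_vec t" "y \<bullet> one_vec t = 0" for y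
  proof -
    have "?\<mu> * (y \<bullet> y) \<le> joint_form ?p ?s d (\<lambda>_. 0) (($) y)"
      using joint_form_carry_ge[OF m, of "($) y"] y by (simp add: scalar_prod_self[OF y(1)] scalar_prod_one_vec)
    also have "\<dots> = y \<bullet> (?C *\<^sub>v y)"
      by (simp add: joint_form_def C22_scalar_prod[OF des y(1) y(1)] residual_form_def direct_part_def)
    finally show ?thesis .
  qed
  note schur = C.schur_complement[OF \<mu> C_ge G(1) car(1) A car(2) B B', folded G(2)]
  show "contrast_matrix t M" by (rule schur(1))
  show "\<exists>y \<in> carrier_vec t. y \<bullet> one_vec t = 0 \<and>
      x \<bullet> (M *\<^sub>v x) = joint_form (t - m) (g * t) d (($) x) (($) y)" if "x \<in> carrier_vec t"
  proof -
    have "\<exists>y \<in> carrier_vec t. y \<bullet> one_vec t = 0 \<and> x \<bullet> (M *\<^sub>v x) =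
        x \<bullet> (?A *\<^sub>v x) + 2 * (x \<bullet> (?B *\<^sub>v y)) + y \<bullet> (?C *\<^sub>v y)"
      by (rule schur(2)) (use that in auto)
    thus ?thesis using that by (simp add: joint_form_eq[OF des] cong: bex_cong)
  qed
  show "x \<bullet> (M *\<^sub>v x) \<le> joint_form (t - m) (g * t) d (($) x) (($) y)"
    if "x \<in> carrier_vec t" "y \<in> carrier_vec t"
  proof -
    have "x \<bullet> (M *\<^sub>v x) \<le> x \<bullet> (?A *\<^sub>v x) + 2 * (x \<bullet> (?B *\<^sub>v y)) + y \<bullet> (?C *\<^sub>v y)"
      by (rule schur(3)) (use that in auto)
    thus ?thesis using that by (simp add: joint_form_eq[OF des])
  qed
qed

lemma trace_min:
  assumes m: "m < t" and D: "theta_denom t m > 0"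
    and M: "direct_information_matrix (t - m) (g * t) t d M"
  shows "0 \<le> trace (moore_penrose M)"
    and "theta_L t m > 0 \<Longrightarrow> 0 < trace (moore_penrose M)"
    and "theta_L t m > 0 \<Longrightarrow> trace (moore_penrose M) \<le> (real t - 1) / (g * theta_L t m)"
proof -
  note inf = information_matrix[OF m D M]
  interpret contrast_matrix t M by (rule inf(1))
  have sum0: "(\<Sum>a<t. x $ a) = 0" if "x \<in> carrier_vec t" "x \<bullet> one_vec t = 0" for x
    using that by (simp add: scalar_prod_one_vec)
  show "0 \<le> trace (moore_penrose M)"
  proof (rule trace_moore_penrose_nonneg)
    fix x :: "real vec" assume x: "x \<in> carrier_vec t" "x \<bullet> one_vec t = 0"
    then obtain y where "y \<in> carrier_vec t" "y \<bullet> one_vec t = 0"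
      "x \<bullet> (M *\<^sub>v x) = joint_form (t - m) (g * t) d (($) x) (($) y)" using inf(2) by blast
    thus "0 \<le> x \<bullet> (M *\<^sub>v x)" using joint_form_nonneg[OF m] sum0 x by simp
  qed
  assume pos: "theta_L t m > 0"
  let ?l = "g * theta_L t m" and ?u = "real g * real (t - m)"
  have lower: "?l * (x \<bullet> x) \<le> x \<bullet> (M *\<^sub>v x)" if x: "x \<in> carrier_vec t" "x \<bullet> one_vec t = 0" for x
  proof -
    obtain y where "y \<in> carrier_vec t" "y \<bullet> one_vec t = 0"
      "x \<bullet> (M *\<^sub>v x) = joint_form (t - m) (g * t) d (($) x) (($) y)" using inf(2) x by blast
    thus ?thesis
      using joint_form_ge_theta_L[OF m D sum0 sum0, OF x] by (simp add: scalar_prod_self[OF x(1)])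
  qed
  have upper: "x \<bullet> (M *\<^sub>v x) \<le> ?u * (x \<bullet> x)" if x: "x \<in> carrier_vec t" "x \<bullet> one_vec t = 0" for x
  proof -
    have "x \<bullet> (M *\<^sub>v x) \<le> joint_form (t - m) (g * t) d (($) x) (($) (0\<^sub>v t))"
      by (rule inf(3)) (use x in auto)
    also have "\<dots> = joint_form (t - m) (g * t) d (($) x) (\<lambda>_. 0)"
      by (rule joint_form_cong[OF truncated_design]) auto
    also have "\<dots> \<le> ?u * (x \<bullet> x)"
      using joint_form_direct_le[OF m sum0[OF x]] by (simp add: scalar_prod_self[OF x(1)])
    finally show ?thesis .
  qed
  have u: "?u > 0" "?l > 0" using pos g_pos m by auto
  note bounds = trace_moore_penrose_eigenvalue_bounds[OF u(2) lower u(1) upper]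
  show "0 < trace (moore_penrose M)"
    using bounds(1) u(1) t_gt_1 by (smt (verit) divide_pos_pos of_nat_1 of_nat_less_iff)
  show "trace (moore_penrose M) \<le> (real t - 1) / ?l" by (rule bounds(2))
qed

text \<open>The trial y from \<open>joint_form_plan\<close> meets the general lower bound, so on
  contrasts the form of M is exactly g times \<open>theta_L t 0\<close> times the squared
  length.\<close>

lemma trace_plan:
  assumes D: "theta_denom t 0 > 0" and pos: "theta_L t 0 > 0"
    and M: "direct_information_matrix t (g * t) t d M"
  shows "(real t - 1) / (g * theta_L t 0) \<le> trace (moore_penrose M)"
proof -
  have m: "0 < t" using t_gt_1 by simp
  note inf = information_matrix[OF m D, unfolded diff_zero, OF M]
  interpret contrast_matrix t M by (rule inf(1))
  have sum0: "(\<Sum>a<t. x $ a) = 0" if "x \<in> carrier_vec t" "x \<bullet> one_vec t = 0" for x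
    using that by (simp add: scalar_prod_one_vec)
  let ?l = "g * theta_L t 0"
  have lower: "?l * (x \<bullet> x) \<le> x \<bullet> (M *\<^sub>v x)" if x: "x \<in> carrier_vec t" "x \<bullet> one_vec t = 0" for x
  proof -
    obtain y where "y \<in> carrier_vec t" "y \<bullet> one_vec t = 0"
      "x \<bullet> (M *\<^sub>v x) = joint_form t (g * t) d (($) x) (($) y)" using inf(2) x by blast
    thus ?thesis
      using joint_form_ge_theta_L[OF m D sum0 sum0, OF x] by (simp add: scalar_prod_self[OF x(1)])
  qed
  have upper: "x \<bullet> (M *\<^sub>v x) \<le> ?l * (x \<bullet> x)" if x: "x \<in> carrier_vec t" "x \<bullet> one_vec t = 0" for x
  proof -
    let ?c = "t / theta_denom t 0"
    have "x \<bullet> (M *\<^sub>v x) \<le> joint_form t (g * t) d (($) x) (($) (?c \<cdot>\<^sub>v x))"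
      by (rule inf(3)) (use x in auto)
    also have "\<dots> = joint_form t (g * t) d (($) x) (\<lambda>a. ?c * x $ a)"
      by (rule joint_form_cong[OF truncated_design[of 0, unfolded diff_zero]]) (use x in auto)
    also have "\<dots> = ?l * (x \<bullet> x)"
      using joint_form_plan[OF sum0[OF x] D] by (simp add: scalar_prod_self[OF x(1)])
    finally show ?thesis .
  qed
  have l: "?l > 0" using pos g_pos by auto
  show ?thesis by (rule trace_moore_penrose_eigenvalue_bounds(1)[OF l lower l upper])
qed

end

theorem corollary8:
  fixes t m g :: nat and d_plan :: design and C_plan C_min :: "real mat"
  assumes "t \<ge> 4" and "1 \<le> m" and "m < t - 1"
    and "UBRMD t g d_plan"
    and "direct_information_matrix t (g * t) t d_plan C_plan"
    and "direct_information_matrix (t - m) (g * t) t d_plan C_min"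
    and "theta_denom t m > 0"
  shows "precision_loss t C_plan C_min
           = 1 - trace (moore_penrose C_plan) / trace (moore_penrose C_min)
         \<and> precision_loss t C_plan C_min \<le> UML t m"
proof -
  interpret ubrm_design t g d_plan
    by unfold_locales (use assms in auto)
  let ?n = "real t" and ?P = "trace (moore_penrose C_plan)" and ?Q = "trace (moore_penrose C_min)"
  have n: "?n \<ge> 4" using assms(1) by simp
  have sq: "?n * ?n \<ge> 4 * ?n" using n by (intro mult_right_mono) auto
  have D0: "theta_denom t 0 = ?n\<^sup>2 - ?n - 1" by (simp add: theta_denom_def)
  have D0_pos: "?n\<^sup>2 - ?n - 1 > 0" using sq n unfolding power2_eq_square by linarith
  \<comment> \<open>With D = t^2 - t - 1, the value t(1 - 1/D) is rewritten by D - 1 = (t - 2)(t +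
    1). This explains the constants in \<open>UML\<close>.\<close>
  have theta0: "theta_L t 0 = ?n * (?n - 2) * (?n + 1) / (?n\<^sup>2 - ?n - 1)"
    unfolding theta_L_def D0 using n D0_pos by (simp add: field_simps power2_eq_square)
  have theta0_pos: "theta_L t 0 > 0"
    unfolding theta0 using n by (intro divide_pos_pos mult_pos_pos D0_pos) auto
  have UML: "UML t m = 1 - theta_L t m / theta_L t 0"
    unfolding UML_def theta0 by (simp add: mult.commute)
  have P: "(?n - 1) / (g * theta_L t 0) \<le> ?P"
    by (rule trace_plan[OF _ theta0_pos assms(5)]) (use D0 D0_pos in simp)
  have "(?n - 1) / (g * theta_L t 0) > 0"
    using n g_pos theta0_pos by simp
  hence P_pos: "?P > 0" using P by linarith
  have m: "m < t" using assms(3) by simp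
  note Q = trace_min[OF m assms(7,6)]
  \<comment> \<open>If the trace for the truncated design is 0, division by zero makes its precision
    and the quotient of traces 0, and both sides equal 1.\<close>
  have loss: "precision_loss t C_plan C_min = 1 - ?P / ?Q"
    using n P_pos by (cases "?Q = 0") (simp_all add: precision_loss_def precision_def field_simps)
  have "theta_L t m / theta_L t 0 \<le> ?P / ?Q"
  proof (cases "theta_L t m > 0")
    case True
    have "theta_L t m / theta_L t 0 = (?n - 1) / (g * theta_L t 0) / ((?n - 1) / (g * theta_L t m))"
      using n g_pos True theta0_pos by (simp add: field_simps)
    also have "\<dots> \<le> ?P / ?Q"
      using P Q(2,3)[OF True] P_pos by (intro frac_le) auto
    finally show ?thesis .
  next
    case False
    hence "theta_L t m / theta_L t 0 \<le> 0" using theta0_pos by (simp add: divide_nonpos_pos)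
    also have "0 \<le> ?P / ?Q" using P_pos Q(1) by simp
    finally show ?thesis .
  qed
  thus ?thesis using loss UML by simp
qed

end
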